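(* Let seed data $(\phi_1,\phi_2)$ be given. There exists $\delta'>0$ depending only on the seed data such that for all $\delta<\delta'$ one can construct a function $\phi_0\in C^\infty((0,1]\times\mathbb{S}^2)$ with the following two properties. (1) For all $k\in\mathbb{Z}_{\ge0}$, the $C^k$ norm of $\phi_0$ is bounded by a function of the $C^k$ norms of $\phi_1$ and $\phi_2$. (2) Suppose initial data for $$-\bigl(1+3G''(0)(\partial_t\phi)^2\bigr)\partial_t^2\phi+\Delta\phi=0$$ are posed on $\Sigma_{-r_0}=\{t=-r_0\}$ as follows: $(\phi,\partial_t\phi)(-r_0,x)=(0,0)$ for $r(x)\le r_0$, and for $r_0\le r(x)\le r_0+\delta$ $$\phi(-r_0,x)=\frac{\delta^{3/2}}{r_0}\phi_0\Bigl(\frac{r-r_0}{\delta},\theta\Bigr),\qquad(\partial_t\phi)(-r_0,x)=\frac{\delta^{1/2}}{r_0}\phi_1\Bigl(\frac{r-r_0}{\delta},\theta\Bigr).$$ Then $$\|\underline{L}\phi\|_{L^\infty(\Sigma^\delta_{-r_0})}\lesssim\frac{\delta^{3/2}}{r_0^2},\qquad \|\underline{L}^2\phi\|_{L^\infty(\Sigma^\delta_{-r_0})}\lesssim\frac{\delta^{3/2}}{r_0^3}.$$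
   Context: $G''(0)\ne0$ is a fixed real constant; $r_0>2$ is an arbitrarily large parameter. Seed data: a pair $(\phi_1(s,\theta),\phi_2(s,\theta))$ of functions in $C_0^\infty((0,1]\times\mathbb{S}^2)$ (smooth, vanishing near $s=0$), freely prescribed and independent of $\delta$ and $r_0$. $r=|x|$, $\theta=x/|x|\in\mathbb{S}^2$, $\Sigma^\delta_{-r_0}=\{x\in\Sigma_{-r_0}: r_0\le r(x)\le r_0+\delta\}$, $c:=(1+3G''(0)(\partial_t\phi)^2)^{-1/2}$ and $\underline{L}:=\partial_t-c\,\partial_r$. The quantity $\underline{L}^2\phi$ on $\Sigma_{-r_0}$ is computed from the data using the equation to express $\partial_t^2\phi$. The implicit constants in $\lesssim$ depend only on the seed data (not on $\delta$ or $r_0$). The function $\phi_0$ may depend on $\delta$ and $r_0$, but the bounds in (1) do not. *)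

theory Defs
  imports "HOL-Analysis.Analysis" "HOL-Probability.Essential_Supremum"
begin

section \<open>Functions of class C^k\<close>

text \<open>
  Derivatives are taken within \<open>S\<close>. If \<open>S\<close> is open they are the usual ones; if \<open>S\<close> has boundary
  points (below: \<open>s = 1\<close>) they are one-sided there, so that \<open>Ck_on k S f\<close> means that \<open>f\<close> is of
  class C^k up to that part of the boundary.
\<close>

fun Ck_on :: "nat \<Rightarrow> 'a::real_normed_vector set \<Rightarrow> ('a \<Rightarrow> real) \<Rightarrow> bool" where
  "Ck_on 0 S f \<longleftrightarrow> continuous_on S f"
| "Ck_on (Suc k) S f \<longleftrightarrow>
     f differentiable_on S \<and> (\<forall>v. Ck_on k S (\<lambda>x. frechet_derivative f (at x within S) v))"

fun iter_deriv :: "'a::real_normed_vector set \<Rightarrow> 'a list \<Rightarrow> ('a \<Rightarrow> real) \<Rightarrow> 'a \<Rightarrow> real" where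
  "iter_deriv S [] f = f"
| "iter_deriv S (v # vs) f = iter_deriv S vs (\<lambda>x. frechet_derivative f (at x within S) v)"


section \<open>Functions on the cylinder (0,1] \<open>\<times>\<close> S^2\<close>

text \<open>
  A function on (0,1] \<open>\<times>\<close> S^2 is represented by a total function on \<open>real \<times> real^3\<close> of which only
  the values on \<open>cyl\<close> matter. It is smooth (resp. its derivatives are measured) through its
  extension \<open>(s, y) \<mapsto> \<phi> (s, y / |y|)\<close>, homogeneous of degree 0 in \<open>y\<close>, to
  (0,1] \<open>\<times>\<close> (R^3 minus the origin). Since this extension is the pull-back of \<open>\<phi>\<close> by a submersion
  restricting to the identity on \<open>cyl\<close>, it is smooth iff \<open>\<phi>\<close> is, and the norm \<open>Ck_norm\<close> (all
  Cartesian derivatives of order at most \<open>k\<close>, evaluated on \<open>cyl\<close>) is one of the usual equivalent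
  C^k norms on the cylinder. It is extended-real-valued because (0,1] is not compact.
\<close>

definition cyl :: "(real \<times> (real^3)) set" where
  "cyl = {0<..1} \<times> sphere 0 1"

definition cyl_ext :: "(real \<times> (real^3)) set" where
  "cyl_ext = {0<..1} \<times> (- {0})"

definition hom_ext :: "(real \<times> (real^3) \<Rightarrow> real) \<Rightarrow> real \<times> (real^3) \<Rightarrow> real" where
  "hom_ext \<phi> = (\<lambda>(s, y). \<phi> (s, y /\<^sub>R norm y))"

definition smooth_cyl :: "(real \<times> (real^3) \<Rightarrow> real) \<Rightarrow> bool" where
  "smooth_cyl \<phi> \<longleftrightarrow> (\<forall>k. Ck_on k cyl_ext (hom_ext \<phi>))"

definition vanishes_near_zero :: "(real \<times> (real^3) \<Rightarrow> real) \<Rightarrow> bool" where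
  "vanishes_near_zero \<phi> \<longleftrightarrow> (\<exists>\<epsilon>>0. \<forall>(s, \<theta>)\<in>cyl. s < \<epsilon> \<longrightarrow> \<phi> (s, \<theta>) = 0)"

definition Ck_norm :: "nat \<Rightarrow> (real \<times> (real^3) \<Rightarrow> real) \<Rightarrow> ereal" where
  "Ck_norm k \<phi> =
     (SUP vs \<in> {vs. set vs \<subseteq> Basis \<and> length vs \<le> k}. SUP p \<in> cyl.
        ereal \<bar>iter_deriv cyl_ext vs (hom_ext \<phi>) p\<bar>)"

definition seed_data :: "(real \<times> (real^3) \<Rightarrow> real) \<Rightarrow> (real \<times> (real^3) \<Rightarrow> real) \<Rightarrow> bool" where
  "seed_data \<phi>1 \<phi>2 \<longleftrightarrow>
     smooth_cyl \<phi>1 \<and> vanishes_near_zero \<phi>1 \<and> smooth_cyl \<phi>2 \<and> vanishes_near_zero \<phi>2"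


section \<open>The wave equation\<close>

text \<open>Spacetime points are pairs \<open>(t, x)\<close>; the real parameter \<open>G2\<close> stands for \<open>G''(0)\<close>.\<close>

definition dt :: "(real \<times> (real^3) \<Rightarrow> real) \<Rightarrow> real \<times> (real^3) \<Rightarrow> real" where
  "dt u p = frechet_derivative u (at p) (1, 0)"

definition dx :: "real^3 \<Rightarrow> (real \<times> (real^3) \<Rightarrow> real) \<Rightarrow> real \<times> (real^3) \<Rightarrow> real" where
  "dx e u p = frechet_derivative u (at p) (0, e)"

definition dr :: "(real \<times> (real^3) \<Rightarrow> real) \<Rightarrow> real \<times> (real^3) \<Rightarrow> real" where
  "dr u p = dx (snd p /\<^sub>R norm (snd p)) u p"

definition laplacian :: "(real \<times> (real^3) \<Rightarrow> real) \<Rightarrow> real \<times> (real^3) \<Rightarrow> real" where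
  "laplacian u p = (\<Sum>e\<in>Basis. dx e (dx e u) p)"

definition wave_eq :: "real \<Rightarrow> (real \<times> (real^3) \<Rightarrow> real) \<Rightarrow> real \<times> (real^3) \<Rightarrow> bool" where
  "wave_eq G2 u p \<longleftrightarrow> - (1 + 3 * G2 * (dt u p)\<^sup>2) * dt (dt u) p + laplacian u p = 0"

definition speed :: "real \<Rightarrow> (real \<times> (real^3) \<Rightarrow> real) \<Rightarrow> real \<times> (real^3) \<Rightarrow> real" where
  "speed G2 u p = (1 + 3 * G2 * (dt u p)\<^sup>2) powr (-1/2)"

text \<open>The vector field \<open>\<partial>\<^sub>t - c \<partial>\<^sub>r\<close>, with \<open>c\<close> determined by \<open>u\<close>, applied to \<open>f\<close>.\<close>

definition Lbar :: "real \<Rightarrow> (real \<times> (real^3) \<Rightarrow> real) \<Rightarrow> (real \<times> (real^3) \<Rightarrow> real)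
    \<Rightarrow> real \<times> (real^3) \<Rightarrow> real" where
  "Lbar G2 u f p = dt f p - speed G2 u p * dr f p"


section \<open>Data on \<open>t = -r0\<close>\<close>

text \<open>
  The formulas for \<open>r0 < |x|\<close> are not imposed on \<open>|x| = r0\<close>, where they would involve a value at
  \<open>s = 0\<close>, outside (0,1]; there the data are zero by the first clause. The two
  clauses fit together smoothly across \<open>|x| = r0\<close> when \<open>\<phi>0\<close> and \<open>\<phi>1\<close> vanish near \<open>s = 0\<close>.
\<close>

definition short_pulse_data :: "real \<Rightarrow> real \<Rightarrow> (real \<times> (real^3) \<Rightarrow> real) \<Rightarrow> (real \<times> (real^3) \<Rightarrow> real)
    \<Rightarrow> (real \<times> (real^3) \<Rightarrow> real) \<Rightarrow> bool" where
  "short_pulse_data r0 \<delta> \<phi>0 \<phi>1 u \<longleftrightarrow>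
     (\<forall>x. norm x \<le> r0 \<longrightarrow> u (-r0, x) = 0 \<and> dt u (-r0, x) = 0) \<and>
     (\<forall>x. r0 < norm x \<and> norm x < r0 + \<delta> \<longrightarrow>
        u (-r0, x) = \<delta> powr (3/2) / r0 * \<phi>0 ((norm x - r0) / \<delta>, x /\<^sub>R norm x) \<and>
        dt u (-r0, x) = \<delta> powr (1/2) / r0 * \<phi>1 ((norm x - r0) / \<delta>, x /\<^sub>R norm x))"

text \<open>
  \<open>u\<close> is a C^2 function near the open ball \<open>|x| < r0 + \<delta>\<close> in \<open>t = -r0\<close> which has the prescribed
  data and satisfies the equation at the points of that ball. Every classical solution of the
  Cauchy problem is such a function; on the other hand the equation at \<open>t = -r0\<close> is all that is
  needed to express the second time derivative, hence \<open>Lbar (Lbar u)\<close>, through the data. The sphere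
  \<open>|x| = r0 + \<delta>\<close> is the edge of the domain of the data; nothing is assumed there, as it is
  negligible for the norm \<open>Linf_norm\<close> below.
\<close>

definition solves_initially :: "real \<Rightarrow> real \<Rightarrow> real \<Rightarrow> (real \<times> (real^3) \<Rightarrow> real)
    \<Rightarrow> (real \<times> (real^3) \<Rightarrow> real) \<Rightarrow> (real \<times> (real^3) \<Rightarrow> real) \<Rightarrow> bool" where
  "solves_initially G2 r0 \<delta> \<phi>0 \<phi>1 u \<longleftrightarrow>
     (\<exists>U. open U \<and> {-r0} \<times> ball 0 (r0 + \<delta>) \<subseteq> U \<and> Ck_on 2 U u) \<and>
     (\<forall>x \<in> ball 0 (r0 + \<delta>). wave_eq G2 u (-r0, x)) \<and>
     short_pulse_data r0 \<delta> \<phi>0 \<phi>1 u"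

definition annulus :: "real \<Rightarrow> real \<Rightarrow> (real^3) set" where
  "annulus r0 \<delta> = {x. r0 \<le> norm x \<and> norm x \<le> r0 + \<delta>}"

definition Linf_norm :: "(real^3) set \<Rightarrow> (real^3 \<Rightarrow> real) \<Rightarrow> ereal" where
  "Linf_norm A f = esssup (restrict_space lebesgue A) (\<lambda>x. ereal \<bar>f x\<bar>)"

end

theory Submission
  imports Defs
begin

text \<open>
  Put \<open>\<epsilon> = \<delta> / r0\<close>, \<open>\<kappa> = \<delta> / r0^2\<close> and \<open>I f (s, \<theta>) = \<integral>_0^s f (\<sigma>, \<theta>) d\<sigma>\<close>. The profile is
  \<open>\<phi>0 = I \<phi>1 + (G''(0) / 2) \<kappa> I (\<phi>1^3) - \<epsilon> I (I \<phi>1)\<close>.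
  On the slice, \<open>\<partial>\<^sub>t\<^sup>2 \<phi> = c\<^sup>2 \<Delta>\<phi>\<close> and polar coordinates turn \<open>Lbar (Lbar \<phi>)\<close> into \<open>\<delta>^(-1/2) / r0\<close> times a
  polynomial in c and in the derivatives of \<open>\<phi>0\<close> and \<open>\<phi>1\<close>. Its terms of order 0 in \<open>\<epsilon>\<close> cancel
  because \<open>\<partial>\<^sub>s \<phi>0 = \<phi>1 + O(\<epsilon>)\<close>. In order 1, the cubic term of \<open>\<phi>0\<close> compensates \<open>c = 1 - (3/2) G''(0) \<kappa> \<phi>1^2 + O(\<epsilon>\<^sup>2)\<close>,
  the double integral compensates the term \<open>(2 / r) \<partial>\<^sub>r \<phi>\<close> of the Laplacian, and the two nonlinear
  contributions of \<open>\<partial>\<^sub>t c\<close> and \<open>\<partial>\<^sub>r c\<close> cancel each other; \<open>O(\<epsilon>\<^sup>2)\<close> is left.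
\<close>

section \<open>Functions of class C^k and bounds on their derivatives\<close>

text \<open>Write ' for d/ds. The first bound asks only for \<phi>0' = \<phi>1 + O(\<epsilon>) and
  leaves the order \<epsilon> of the profile free; the second bound fixes it. Up to O(\<epsilon>^2)
  it requires c (\<phi>0'' + \<epsilon> \<phi>0') = \<phi>1', that is \<phi>0'' = \<phi>1' / c -
  \<epsilon> \<phi>1. Since (\<partial>t \<phi>)^2 = \<kappa> \<phi>1^2, here 1 / c is 1 + (3/2)
  G''(0) \<kappa> \<phi>1^2 to the same accuracy, and \<phi>1' times this is the s-derivative of
  \<phi>1 + (G''(0) / 2) \<kappa> \<phi>1^3. Hence the coefficient, and hence plain integrals in s
  suffice instead of solving an equation for \<phi>0. The obstacle is uniformity: one constant must
  serve all \<delta>, r0, x and u. The expansion is therefore done with explicit remainders, for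
  families indexed by triples (\<delta>, r0, x), and u enters only through derivatives on the slice,
  all of which the data and the equation determine.\<close>

definition axis_accessible :: "'a::euclidean_space set \<Rightarrow> bool" where
  "axis_accessible S \<longleftrightarrow>
     (\<forall>x\<in>S. \<forall>i\<in>Basis. \<forall>e>0. \<exists>d. 0 < \<bar>d\<bar> \<and> \<bar>d\<bar> < e \<and> x + d *\<^sub>R i \<in> S)"

text \<open>A derivative within a set is unique only if the set can be approached along every
  coordinate axis. \<open>axis_accessible\<close> allows either sign of the step, so boundary points
  with s = 1 qualify, and an explicit derivative may replace the chosen one there too.\<close>

lemma frechet_derivative_within_eqI:
  assumes "axis_accessible S" "x \<in> S" "(f has_derivative f') (at x within S)"
  shows "frechet_derivative f (at x within S) = f'"
proof -
  have "(f has_derivative frechet_derivative f (at x within S)) (at x within S)"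
    using assms(3) frechet_derivative_works differentiable_def by blast
  from frechet_derivative_unique_within[OF this assms(3)] assms(1,2)
  show ?thesis by (auto simp: axis_accessible_def)
qed

lemma frechet_derivative_within_cong:
  assumes "x \<in> S" "\<And>y. y \<in> S \<Longrightarrow> f y = g y"
  shows "frechet_derivative f (at x within S) = frechet_derivative g (at x within S)"
proof -
  \<comment> \<open>Both functions have the same candidates for a derivative, so the choice in
    \<open>frechet_derivative\<close> agrees even where neither is differentiable.\<close>
  have "(f has_derivative f') (at x within S) \<longleftrightarrow> (g has_derivative f') (at x within S)" for f'
    using assms has_derivative_transform[of x S] by metis
  then show ?thesis by (simp add: frechet_derivative_def)
qed

lemma Ck_on_cong:
  assumes "\<And>y. y \<in> S \<Longrightarrow> f y = g y"
  shows "Ck_on k S f \<longleftrightarrow> Ck_on k S g"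
  using assms
proof (induction k arbitrary: f g)
  case 0
  then show ?case by (simp cong: continuous_on_cong)
next
  case (Suc k)
  have "f differentiable_on S \<longleftrightarrow> g differentiable_on S"
    unfolding differentiable_on_def differentiable_def
    using Suc.prems has_derivative_transform[of _ S] by metis
  moreover have "Ck_on k S (\<lambda>x. frechet_derivative f (at x within S) v)
      \<longleftrightarrow> Ck_on k S (\<lambda>x. frechet_derivative g (at x within S) v)" for v
    by (rule Suc.IH) (metis Suc.prems frechet_derivative_within_cong)
  ultimately show ?case by simp
qed

lemma Ck_on_Suc_differentiable: "Ck_on (Suc k) S f \<Longrightarrow> f differentiable_on S"
  and Ck_on_Suc_deriv: "Ck_on (Suc k) S f \<Longrightarrow> Ck_on k S (\<lambda>x. frechet_derivative f (at x within S) v)"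
  unfolding Ck_on.simps(2) by (erule conjunct1, erule spec[OF conjunct2])

lemma Ck_on_SucD: "Ck_on (Suc k) S f \<Longrightarrow> Ck_on k S f"
proof (induction k arbitrary: f)
  case 0
  then show ?case by (simp add: differentiable_imp_continuous_on)
next
  case (Suc k)
  then show ?case by (metis Ck_on.simps(2))
qed

lemma Ck_on_mono: "Ck_on m S f \<Longrightarrow> k \<le> m \<Longrightarrow> Ck_on k S f"
  by (induction m) (auto simp: le_Suc_eq dest: Ck_on_SucD simp del: Ck_on.simps)

lemma Ck_on_imp_continuous_on: "Ck_on k S f \<Longrightarrow> continuous_on S f"
  using Ck_on_mono[of k S f 0] by simp

lemma frechet_derivative_within_has_derivative:
  "f differentiable_on S \<Longrightarrow> x \<in> S
    \<Longrightarrow> (f has_derivative frechet_derivative f (at x within S)) (at x within S)"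
  by (simp add: differentiable_on_def frechet_derivative_works[symmetric])

context
  fixes S :: "'a::euclidean_space set"
  assumes S: "axis_accessible S"
begin

lemma Ck_on_SucI:
  assumes "\<And>x. x \<in> S \<Longrightarrow> (f has_derivative f' x) (at x within S)"
    and "\<And>v. Ck_on k S (\<lambda>x. f' x v)"
  shows "Ck_on (Suc k) S f"
proof -
  have "f differentiable_on S"
    using assms(1) by (auto simp: differentiable_on_def differentiable_def)
  moreover have "Ck_on k S (\<lambda>x. frechet_derivative f (at x within S) v)" for v
    using assms(2)[of v] Ck_on_cong[of S "\<lambda>x. frechet_derivative f (at x within S) v" "\<lambda>x. f' x v"]
      frechet_derivative_within_eqI[OF S _ assms(1)] by simp
  ultimately show ?thesis by simp
qed

lemma Ck_on_const: "Ck_on k S (\<lambda>x. c)"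
  by (induction k arbitrary: c)
    (auto intro!: Ck_on_SucI[OF has_derivative_const] simp del: Ck_on.simps(2))

lemma Ck_on_add: "Ck_on k S f \<Longrightarrow> Ck_on k S g \<Longrightarrow> Ck_on k S (\<lambda>x. f x + g x)"
proof (induction k arbitrary: f g)
  case (Suc k)
  show ?case
    by (rule Ck_on_SucI, rule has_derivative_add)
      (use Suc in \<open>auto intro: frechet_derivative_within_has_derivative\<close>)
qed (auto intro: continuous_intros)

lemma Ck_on_mult: "Ck_on k S f \<Longrightarrow> Ck_on k S g \<Longrightarrow> Ck_on k S (\<lambda>x. f x * g x)"
proof (induction k arbitrary: f g)
  case (Suc k)
  show ?case
    by (rule Ck_on_SucI, rule has_derivative_mult)
      (use Suc Ck_on_SucD[OF Suc.prems(1)] Ck_on_SucD[OF Suc.prems(2)]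
        in \<open>auto intro!: frechet_derivative_within_has_derivative Ck_on_add\<close>)
qed (auto intro: continuous_intros)

lemma Ck_on_cmult: "Ck_on k S f \<Longrightarrow> Ck_on k S (\<lambda>x. c * f x)"
  by (intro Ck_on_mult Ck_on_const)

end

section \<open>Bounds on all Cartesian derivatives up to order k\<close>

lemma iter_deriv_cong:
  fixes f g :: "'a::real_normed_vector \<Rightarrow> real"
  assumes "\<And>y. y \<in> S \<Longrightarrow> f y = g y" "x \<in> S"
  shows "iter_deriv S vs f x = iter_deriv S vs g x"
  using assms(1)
proof (induction vs arbitrary: f g)
  case (Cons v vs)
  show ?case unfolding iter_deriv.simps
    by (rule Cons.IH) (metis Cons.prems frechet_derivative_within_cong)
qed (use assms in auto)

text \<open>For \<open>S = cyl_ext\<close> and \<open>T = cyl\<close> this is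
  \<open>Ck_norm k\<close> bounded by M, kept in the reals for inductions on k. Differentiation
  needs the larger set S; bounds are asked for on T only, since derivatives of a function
  homogeneous of degree 0 may blow up as y tends to 0.\<close>

definition deriv_bound ::
    "'a::euclidean_space set \<Rightarrow> 'a set \<Rightarrow> nat \<Rightarrow> ('a \<Rightarrow> real) \<Rightarrow> real \<Rightarrow> bool" where
  "deriv_bound S T k f M \<longleftrightarrow>
     (\<forall>vs. set vs \<subseteq> Basis \<and> length vs \<le> k \<longrightarrow> (\<forall>p\<in>T. \<bar>iter_deriv S vs f p\<bar> \<le> M))"

lemma deriv_bound_0: "deriv_bound S T 0 f M \<longleftrightarrow> (\<forall>p\<in>T. \<bar>f p\<bar> \<le> M)"
  by (auto simp: deriv_bound_def)

lemma deriv_bound_Suc: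
  fixes S T :: "'a::euclidean_space set"
  shows "deriv_bound S T (Suc k) f M \<longleftrightarrow> (\<forall>p\<in>T. \<bar>f p\<bar> \<le> M) \<and>
     (\<forall>v\<in>Basis. deriv_bound S T k (\<lambda>x. frechet_derivative f (at x within S) v) M)"
  (is "?L \<longleftrightarrow> ?R")
proof
  assume L: ?L
  have "\<bar>f p\<bar> \<le> M" if "p \<in> T" for p
    using L[unfolded deriv_bound_def, rule_format, of "[]" p] that by simp
  moreover have "deriv_bound S T k (\<lambda>x. frechet_derivative f (at x within S) v) M" if "v \<in> Basis" for v
    unfolding deriv_bound_def
    using L[unfolded deriv_bound_def, rule_format, of "v # _"] that by simp
  ultimately show ?R by simp
next
  assume R: ?R
  show ?L unfolding deriv_bound_def
  proof (intro allI impI ballI)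
    fix vs :: "'a list" and p assume vs: "set vs \<subseteq> Basis \<and> length vs \<le> Suc k" and p: "p \<in> T"
    show "\<bar>iter_deriv S vs f p\<bar> \<le> M"
      using R vs p by (cases vs) (auto simp: deriv_bound_def)
  qed
qed

lemma deriv_bound_D0: "deriv_bound S T k f M \<Longrightarrow> p \<in> T \<Longrightarrow> \<bar>f p\<bar> \<le> M"
  by (cases k) (auto simp: deriv_bound_0 deriv_bound_Suc)

lemma deriv_bound_cong:
  assumes "\<And>y. y \<in> S \<Longrightarrow> f y = g y" "T \<subseteq> S"
  shows "deriv_bound S T k f M \<longleftrightarrow> deriv_bound S T k g M"
  unfolding deriv_bound_def using iter_deriv_cong[of S f g] assms by (auto simp: subset_iff)

lemma deriv_bound_SucD: "deriv_bound S T (Suc k) f M \<Longrightarrow> deriv_bound S T k f M"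
  by (auto simp: deriv_bound_def)

lemma deriv_bound_mono: "deriv_bound S T k f M \<Longrightarrow> M \<le> N \<Longrightarrow> deriv_bound S T k f N"
  by (force simp: deriv_bound_def)

context
  fixes S T :: "'a::euclidean_space set"
  assumes S: "axis_accessible S" and T: "T \<subseteq> S"
begin

lemma deriv_bound_SucI:
  assumes "\<And>x. x \<in> S \<Longrightarrow> (f has_derivative f' x) (at x within S)"
    and "\<And>v. v \<in> Basis \<Longrightarrow> deriv_bound S T k (\<lambda>x. f' x v) M"
    and "\<And>p. p \<in> T \<Longrightarrow> \<bar>f p\<bar> \<le> M"
  shows "deriv_bound S T (Suc k) f M"
proof -
  have "deriv_bound S T k (\<lambda>x. frechet_derivative f (at x within S) v) M" if "v \<in> Basis" for v
    using assms(2)[OF that] T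
      deriv_bound_cong[of S "\<lambda>x. frechet_derivative f (at x within S) v" "\<lambda>x. f' x v" T]
      frechet_derivative_within_eqI[OF S _ assms(1)] by simp
  with assms(3) show ?thesis by (simp add: deriv_bound_Suc)
qed

lemma deriv_bound_add:
  "Ck_on k S f \<Longrightarrow> Ck_on k S g \<Longrightarrow> deriv_bound S T k f M \<Longrightarrow> deriv_bound S T k g N
    \<Longrightarrow> deriv_bound S T k (\<lambda>x. f x + g x) (M + N)"
proof (induction k arbitrary: f g)
  case 0
  then show ?case by (fastforce simp: deriv_bound_0)
next
  case (Suc k)
  have "\<bar>f p + g p\<bar> \<le> M + N" if "p \<in> T" for p
    using Suc.prems deriv_bound_D0[OF _ that] by (meson abs_triangle_ineq add_mono order_trans)
  then show ?case
    by (intro deriv_bound_SucI[OF has_derivative_add])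
      (use Suc in \<open>auto simp: deriv_bound_Suc intro: frechet_derivative_within_has_derivative\<close>)
qed

text \<open>Each derivative turns one product into two, both covered by the induction hypothesis
  with the same M and N. This costs a factor 2 per order and avoids the Leibniz formula.\<close>

lemma deriv_bound_mult:
  "Ck_on k S f \<Longrightarrow> Ck_on k S g \<Longrightarrow> deriv_bound S T k f M \<Longrightarrow> deriv_bound S T k g N \<Longrightarrow> 0 \<le> M \<Longrightarrow> 0 \<le> N
    \<Longrightarrow> deriv_bound S T k (\<lambda>x. f x * g x) (2 ^ k * M * N)"
proof (induction k arbitrary: f g)
  case 0
  then show ?case by (fastforce simp: deriv_bound_0 abs_mult intro: mult_mono)
next
  case (Suc k)
  have b: "\<bar>f p * g p\<bar> \<le> 2 ^ Suc k * M * N" if "p \<in> T" for p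
  proof -
    have "\<bar>f p * g p\<bar> \<le> M * N"
      unfolding abs_mult using Suc.prems deriv_bound_D0[OF _ that] by (intro mult_mono) auto
    also have "\<dots> \<le> 2 ^ Suc k * (M * N)"
      using Suc.prems mult_right_mono[of 1 "2 ^ Suc k" "M * N"] one_le_power[of "2::real" "Suc k"]
      by simp
    finally show ?thesis by (simp add: mult.assoc)
  qed
  let ?D = "\<lambda>f v x. frechet_derivative f (at x within S) v"
  have "deriv_bound S T k (\<lambda>x. f x * ?D g v x + ?D f v x * g x) (2 ^ k * M * N + 2 ^ k * M * N)"
    if "v \<in> Basis" for v
  proof -
    have "Ck_on k S f" "Ck_on k S g" "Ck_on k S (?D f v)" "Ck_on k S (?D g v)"
      using Suc.prems Ck_on_SucD by auto
    moreover have "deriv_bound S T k f M" "deriv_bound S T k g N"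
      using Suc.prems(3,4) by (auto intro: deriv_bound_SucD)
    moreover have "deriv_bound S T k (?D f v) M" "deriv_bound S T k (?D g v) N"
      using Suc.prems(3,4) that by (auto simp: deriv_bound_Suc)
    ultimately show ?thesis
      using Suc.prems(5,6) by (intro deriv_bound_add Suc.IH Ck_on_mult[OF S])
  qed
  then show ?case
    by (intro deriv_bound_SucI[OF has_derivative_mult])
      (use Suc.prems b in \<open>auto intro: frechet_derivative_within_has_derivative simp: algebra_simps\<close>)
qed

lemma deriv_bound_cmult:
  "Ck_on k S f \<Longrightarrow> deriv_bound S T k f M \<Longrightarrow> deriv_bound S T k (\<lambda>x. c * f x) (\<bar>c\<bar> * M)"
proof (induction k arbitrary: f)
  case 0
  then show ?case by (auto simp: deriv_bound_0 abs_mult intro!: mult_left_mono)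
next
  case (Suc k)
  have "\<bar>c * f p\<bar> \<le> \<bar>c\<bar> * M" if "p \<in> T" for p
    using Suc.prems deriv_bound_D0[OF _ that] by (auto simp: abs_mult intro!: mult_left_mono)
  then show ?case
    by (intro deriv_bound_SucI[OF has_derivative_mult_right])
      (use Suc in \<open>auto simp: deriv_bound_Suc intro: frechet_derivative_within_has_derivative\<close>)
qed

end

section \<open>Integration in the first variable\<close>

text \<open>
  If F vanishes for \<open>s \<le> a\<close>, the substitution \<open>\<sigma> = \<tau> s\<close> identifies \<open>sint a F (s, y)\<close> with the integral
  of \<open>F (\<sigma>, y)\<close> over \<open>0 < \<sigma> \<le> s\<close> for all \<open>s \<le> 1\<close>. Fixed limits make \<open>leibniz_rule\<close> applicable, and
  the lower limit \<open>a > 0\<close> keeps \<open>\<tau> s\<close> in (0,1].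
\<close>

definition sint :: "real \<Rightarrow> (real \<times> 'b \<Rightarrow> real) \<Rightarrow> real \<times> 'b \<Rightarrow> real" where
  "sint a F = (\<lambda>(s, y). s * integral {a..1} (\<lambda>\<tau>. F (\<tau> * s, y)))"

lemma sint_eq_0:
  assumes a: "0 < a" "a < 1"
    and F: "\<And>s'. 0 < s' \<Longrightarrow> s' \<le> s \<Longrightarrow> F (s', y) = 0" and s: "0 < s"
  shows "sint a F (s, y) = 0"
proof -
  have "F (\<tau> * s, y) = 0" if "\<tau> \<in> {a..1}" for \<tau>
    using s that a by (intro F mult_left_le_one_le) auto
  then have "integral {a..1} (\<lambda>\<tau>. F (\<tau> * s, y)) = integral {a..1} (\<lambda>\<tau>. 0)"
    by (intro integral_cong) auto
  then show ?thesis by (simp add: sint_def)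
qed

lemma sint_bound:
  assumes a: "0 < a" "a < 1"
    and F: "\<And>s. 0 < s \<Longrightarrow> s \<le> 1 \<Longrightarrow> \<bar>F (s, y)\<bar> \<le> M" and s: "0 < s" "s \<le> 1"
  shows "\<bar>sint a F (s, y)\<bar> \<le> M"
proof -
  have M: "0 \<le> M" using F[of 1] by auto
  have "norm (integral (cbox a 1) (\<lambda>\<tau>. F (\<tau> * s, y))) \<le> M * measure lborel (cbox a 1)"
  \<comment> \<open>A non-integrable function has integral 0 by convention, so the bound requires no
    regularity of F.\<close>
  proof (cases "(\<lambda>\<tau>. F (\<tau> * s, y)) integrable_on cbox a 1")
    case True
    then show ?thesis
      using s a M by (intro integrable_bound) (auto intro!: F simp: mult_le_one)
  qed (use M in \<open>auto simp: not_integrable_integral\<close>)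
  also have "\<dots> \<le> M" using a M mult_left_le[of "1 - a" M] by simp
  finally have "\<bar>integral {a..1} (\<lambda>\<tau>. F (\<tau> * s, y))\<bar> \<le> M" by simp
  then have "s * \<bar>integral {a..1} (\<lambda>\<tau>. F (\<tau> * s, y))\<bar> \<le> 1 * M"
    using s M by (intro mult_mono) auto
  then show ?thesis using s by (simp add: sint_def abs_mult)
qed

section \<open>Differentiation of \<open>sint\<close> up to the boundary s = 1\<close>

context
  fixes V :: "'b::euclidean_space set"
  assumes V: "open V"
begin

abbreviation (input) "SV \<equiv> {0<..1::real} \<times> V"

lemma axis_accessible_strip: "axis_accessible SV"
  unfolding axis_accessible_def
proof (intro ballI allI impI)
  fix x i :: "real \<times> 'b" and e :: real
  assume x: "x \<in> SV" and i: "i \<in> Basis" and e: "0 < e"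
  obtain s y where xe: "x = (s, y)" "0 < s" "s \<le> 1" "y \<in> V" using x by auto
  show "\<exists>d. 0 < \<bar>d\<bar> \<and> \<bar>d\<bar> < e \<and> x + d *\<^sub>R i \<in> SV"
  proof (cases "snd i = 0")
    case True
    then have "i = (1, 0)" using i by (auto simp: Basis_prod_def)
    \<comment> \<open>The step is negative because s may be 1, and at most s / 2 in size so that the
      first coordinate stays positive.\<close>
    then show ?thesis
      using xe e by (intro exI[of _ "- (min (e / 2) (s / 2))"]) auto
  next
    case False
    then obtain b where ib: "i = (0, b)" "b \<in> Basis" using i by (auto simp: Basis_prod_def)
    obtain r where r: "r > 0" "ball y r \<subseteq> V" using V xe openE by blast
    have "y + min (e / 2) (r / 2) *\<^sub>R b \<in> ball y r"
      using ib e r by (simp add: dist_norm)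
    then show ?thesis
      using xe e r ib by (intro exI[of _ "min (e / 2) (r / 2)"]) auto
  qed
qed

text \<open>The region s < b is relatively open, so vanishing there passes to derivatives and
  survives the inductions on k. This is why functions vanish below b while integration starts at a
  smaller a.\<close>

lemma vanishing_frechet_derivative:
  assumes "\<And>s y. 0 < s \<Longrightarrow> s < b \<Longrightarrow> s \<le> 1 \<Longrightarrow> y \<in> V \<Longrightarrow> F (s, y) = 0"
    and "0 < s" "s < b" "s \<le> 1" "y \<in> V"
  shows "frechet_derivative F (at (s, y) within SV) v = 0"
proof -
  have "((\<lambda>_. 0) has_derivative (\<lambda>_. 0)) (at (s, y) within SV \<inter> {0<..<b} \<times> V)" by simp
  then have "(F has_derivative (\<lambda>_. 0)) (at (s, y) within SV \<inter> {0<..<b} \<times> V)"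
    by (rule has_derivative_transform[rotated 2]) (use assms in auto)
  moreover have "at (s, y) within SV \<inter> {0<..<b} \<times> V = at (s, y) within SV"
    by (rule at_within_nhd[of _ "{0<..<b} \<times> V"]) (use assms V in \<open>auto simp: open_Times\<close>)
  ultimately have "(F has_derivative (\<lambda>_. 0)) (at (s, y) within SV)" by simp
  then show ?thesis
    using frechet_derivative_within_eqI[OF axis_accessible_strip, of "(s, y)" F "\<lambda>_. 0"] assms by auto
qed

context
  fixes a :: real
  assumes a: "0 < a" "a < 1"
begin

lemma continuous_on_sint:
  assumes "continuous_on SV F"
  shows "continuous_on SV (sint a F)"
proof -
  have "continuous_on (SV \<times> {a..1}) (\<lambda>(x, \<tau>). F (\<tau> * fst x, snd x))"
    unfolding split_beta
    by (rule continuous_on_compose2[OF assms])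
      (use a in \<open>auto intro!: continuous_intros simp: mult_le_one\<close>)
  then have "continuous_on SV (\<lambda>x. integral (cbox a 1) (\<lambda>\<tau>. F (\<tau> * fst x, snd x)))"
    by (intro integral_continuous_on_param) (simp add: split_beta)
  then show ?thesis
    unfolding sint_def split_beta by (auto intro!: continuous_intros)
qed

text \<open>Differentiation under the integral sign. In the direction of s the integrand is F
  (\<tau> s) + s \<tau> \<partial>F (\<tau> s), the \<tau>-derivative of \<tau> F (\<tau> s); its
  integral is F p, as the boundary term at \<tau> = a vanishes. Only derivatives in y remain under
  the integral.\<close>

lemma has_derivative_sint:
  assumes F: "F differentiable_on SV"
    and cF: "\<And>v. continuous_on SV (\<lambda>x. frechet_derivative F (at x within SV) v)"
    and F0: "\<And>s y. 0 < s \<Longrightarrow> s \<le> a \<Longrightarrow> y \<in> V \<Longrightarrow> F (s, y) = 0"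
    and p: "p \<in> SV"
  shows "(sint a F has_derivative
      (\<lambda>v. fst v * F p + sint a (\<lambda>x. frechet_derivative F (at x within SV) (0, snd v)) p))
      (at p within SV)"
proof -
  define DF where "DF x = frechet_derivative F (at x within SV)" for x
  have DF: "(F has_derivative DF x) (at x within SV)" if "x \<in> SV" for x
    unfolding DF_def using F that by (rule frechet_derivative_within_has_derivative)
  have cF: "continuous_on SV (\<lambda>x. DF x v)" for v using cF by (simp add: DF_def)
  have cF0: "continuous_on SV F" using F by (rule differentiable_imp_continuous_on)
  have lin: "linear (DF x)" if "x \<in> SV" for x
    using DF[OF that] has_derivative_linear by blast
  obtain s y where pe: "p = (s, y)" "0 < s" "s \<le> 1" "y \<in> V" using p by auto
  obtain r where r: "r > 0" "ball y r \<subseteq> V" using V pe openE by blast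
  \<comment> \<open>\<open>leibniz_rule\<close> wants a convex domain and V need not be convex; a
    ball around y suffices, as the claim is local.\<close>
  define U where "U = {0<..1::real} \<times> ball y r"
  have U: "U \<subseteq> SV" "p \<in> U" "convex U"
    using r pe by (auto simp: U_def intro!: convex_Times)
  define g where "g \<tau> x = (\<tau> * fst x, snd x)" for \<tau> :: real and x :: "real \<times> 'b"
  have gSV: "g \<tau> x \<in> SV" if "x \<in> SV" "\<tau> \<in> {a..1}" for \<tau> x
    using that a by (auto simp: g_def mult_le_one)
  \<comment> \<open>The derivative is packaged as a bounded linear function because
    \<open>leibniz_rule\<close> needs it continuous in the operator norm; in finite dimension
    continuity on each basis vector is enough.\<close>
  define fx where "fx x \<tau> = Blinfun (\<lambda>v. DF (g \<tau> x) (g \<tau> v))" for x \<tau>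
  have fg: "((\<lambda>x. F (g \<tau> x)) has_derivative (\<lambda>v. DF (g \<tau> x) (g \<tau> v))) (at x within U)"
    if "x \<in> U" "\<tau> \<in> {a..1}" for x \<tau>
  proof (rule has_derivative_in_compose2[OF DF])
    show "(g \<tau> has_derivative g \<tau>) (at x within U)"
      unfolding g_def by (auto intro!: derivative_eq_intros)
    show "g \<tau> ` U \<subseteq> SV" using that U gSV by blast
  qed (use that in auto)
  have fx_apply: "blinfun_apply (fx x \<tau>) = (\<lambda>v. DF (g \<tau> x) (g \<tau> v))"
    if "x \<in> U" "\<tau> \<in> {a..1}" for x \<tau>
    unfolding fx_def using fg[OF that] by (intro bounded_linear_Blinfun_apply has_derivative_bounded_linear)
  have DF_split: "DF x (g \<tau> v) = \<tau> * fst v * DF x (1, 0) + DF x (0, snd v)" if "x \<in> SV" for x \<tau> v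
  proof -
    have "g \<tau> v = (\<tau> * fst v) *\<^sub>R (1, 0) + (0, snd v)" by (simp add: g_def)
    then show ?thesis
      using lin[OF that] by (metis linear_add linear_scale real_scaleR_def)
  qed
  have cg: "continuous_on (U \<times> {a..1}) (\<lambda>x. H (g (snd x) (fst x)))"
    if "continuous_on SV H" for H :: "real \<times> 'b \<Rightarrow> real"
  proof (rule continuous_on_compose2[OF that])
    show "continuous_on (U \<times> {a..1}) (\<lambda>x. g (snd x) (fst x))"
      unfolding g_def by (intro continuous_intros)
    show "(\<lambda>x. g (snd x) (fst x)) ` (U \<times> {a..1}) \<subseteq> SV"
      by (intro image_subsetI gSV; metis U(1) mem_Times_iff subset_iff)
  qed
  have cfx: "continuous_on (U \<times> cbox a 1) (\<lambda>(x, t). fx x t)"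
    unfolding split_beta
  proof (rule continuous_on_blinfun_componentwise)
    fix i :: "real \<times> 'b"
    have "continuous_on (U \<times> {a..1})
      (\<lambda>x. snd x * fst i * DF (g (snd x) (fst x)) (1, 0) + DF (g (snd x) (fst x)) (0, snd i))"
      by (intro continuous_intros cg cF)
    then show "continuous_on (U \<times> cbox a 1) (\<lambda>x. blinfun_apply (fx (fst x) (snd x)) i)"
      unfolding box_real
      by (rule continuous_on_eq)
        (use U(1) in \<open>auto simp: fx_apply intro!: DF_split[symmetric] gSV\<close>)
  qed
  have slice: "continuous_on {a..1} (\<lambda>\<tau>. H (g \<tau> x))"
    if "continuous_on SV H" "x \<in> U" for H :: "real \<times> 'b \<Rightarrow> real" and x
    by (rule continuous_on_compose2[OF cg[OF that(1)], of _ "\<lambda>\<tau>. (x, \<tau>)", simplified])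
      (use that in \<open>auto intro!: continuous_intros\<close>)
  have int: "((\<lambda>x. integral (cbox a 1) (\<lambda>\<tau>. F (g \<tau> x))) has_derivative integral (cbox a 1) (fx p))
      (at p within U)"
  proof (rule leibniz_rule[OF _ _ cfx])
    show "((\<lambda>x. F (g \<tau> x)) has_derivative blinfun_apply (fx x \<tau>)) (at x within U)"
      if "x \<in> U" "\<tau> \<in> cbox a 1" for x \<tau>
      using fg[of x \<tau>] that by (simp add: fx_apply)
    show "(\<lambda>\<tau>. F (g \<tau> x)) integrable_on cbox a 1" if "x \<in> U" for x
      using slice[OF cF0 that] by (intro integrable_continuous) simp
  qed (use U in auto)
  have fxi: "fx p integrable_on cbox a 1"
  proof (rule integrable_continuous)
    show "continuous_on (cbox a 1) (fx p)"
      by (rule continuous_on_compose2[OF cfx, of _ "\<lambda>\<tau>. (p, \<tau>)", simplified])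
        (use U in \<open>auto intro!: continuous_intros\<close>)
  qed
  have ifx: "blinfun_apply (integral (cbox a 1) (fx p)) v
      = fst v * integral {a..1} (\<lambda>\<tau>. \<tau> * DF (g \<tau> p) (1, 0))
        + integral {a..1} (\<lambda>\<tau>. DF (g \<tau> p) (0, snd v))" for v
  proof -
    have "blinfun_apply (integral (cbox a 1) (fx p)) v
        = integral {a..1} (\<lambda>\<tau>. fst v * (\<tau> * DF (g \<tau> p) (1, 0)) + DF (g \<tau> p) (0, snd v))"
      unfolding blinfun_apply_integral[OF fxi] unfolding box_real
      by (intro integral_cong) (use U gSV in \<open>auto simp: fx_apply DF_split\<close>)
    also have "\<dots> = integral {a..1} (\<lambda>\<tau>. fst v * (\<tau> * DF (g \<tau> p) (1, 0)))
        + integral {a..1} (\<lambda>\<tau>. DF (g \<tau> p) (0, snd v))"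
      by (intro integral_add integrable_continuous_real continuous_intros slice cF U)
    finally show ?thesis by simp
  qed
  \<comment> \<open>The fundamental theorem for \<tau> F (\<tau> s, y) between a and 1: the lower
    end contributes 0 because a s is at most a.\<close>
  have ftc: "integral {a..1} (\<lambda>\<tau>. F (g \<tau> p)) + s * integral {a..1} (\<lambda>\<tau>. \<tau> * DF (g \<tau> p) (1, 0)) = F p"
  proof -
    have "((\<lambda>\<tau>. \<tau> * F (g \<tau> p)) has_vector_derivative (F (g \<tau> p) + s * (\<tau> * DF (g \<tau> p) (1, 0))))
        (at \<tau> within {a..1})" if t: "\<tau> \<in> {a..1}" for \<tau>
    proof -
      have "((\<lambda>\<tau>. F (g \<tau> p)) has_derivative (\<lambda>h. DF (g \<tau> p) (h * s, 0))) (at \<tau> within {a..1})"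
      proof (rule has_derivative_in_compose2[OF DF])
        show "((\<lambda>\<tau>. g \<tau> p) has_derivative (\<lambda>h. (h * s, 0))) (at \<tau> within {a..1})"
          unfolding g_def pe by (auto intro!: derivative_eq_intros)
        show "(\<lambda>\<tau>. g \<tau> p) ` {a..1} \<subseteq> SV" using p gSV by blast
      qed (use t in auto)
      then have "((\<lambda>\<tau>. \<tau> * F (g \<tau> p)) has_derivative
          (\<lambda>h. \<tau> * DF (g \<tau> p) (h * s, 0) + h * F (g \<tau> p))) (at \<tau> within {a..1})"
        by (rule has_derivative_mult[OF has_derivative_ident])
      moreover have "DF (g \<tau> p) (h * s, 0) = h * s * DF (g \<tau> p) (1, 0)" for h
        using DF_split[of "g \<tau> p" 1 "(h * s, 0)"] gSV[OF p t] linear_0[OF lin[OF gSV[OF p t]]]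
        by (simp add: g_def zero_prod_def)
      ultimately show ?thesis
        by (simp add: has_vector_derivative_def algebra_simps)
    qed
    then have "((\<lambda>\<tau>. F (g \<tau> p) + s * (\<tau> * DF (g \<tau> p) (1, 0))) has_integral (1 * F (g 1 p) - a * F (g a p))) {a..1}"
      using a by (intro fundamental_theorem_of_calculus) auto
    moreover have "F (g a p) = 0" using F0[of "a * s" y] pe a mult_left_le[of s a] by (simp add: g_def)
    moreover have "g 1 p = p" by (simp add: g_def)
    ultimately have "integral {a..1} (\<lambda>\<tau>. F (g \<tau> p) + s * (\<tau> * DF (g \<tau> p) (1, 0))) = F p"
      by (simp add: integral_unique)
    moreover have "integral {a..1} (\<lambda>\<tau>. F (g \<tau> p) + s * (\<tau> * DF (g \<tau> p) (1, 0)))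
      = integral {a..1} (\<lambda>\<tau>. F (g \<tau> p)) + integral {a..1} (\<lambda>\<tau>. s * (\<tau> * DF (g \<tau> p) (1, 0)))"
      by (intro integral_add integrable_continuous_real continuous_intros slice cF cF0 U)
    ultimately show ?thesis by simp
  qed
  have "((\<lambda>x. fst x * integral (cbox a 1) (\<lambda>\<tau>. F (g \<tau> x))) has_derivative
      (\<lambda>v. fst p * blinfun_apply (integral (cbox a 1) (fx p)) v + fst v * integral (cbox a 1) (\<lambda>\<tau>. F (g \<tau> p))))
      (at p within U)"
    by (intro has_derivative_mult int has_derivative_fst has_derivative_ident)
  moreover have "(\<lambda>v. fst p * blinfun_apply (integral (cbox a 1) (fx p)) v + fst v * integral (cbox a 1) (\<lambda>\<tau>. F (g \<tau> p)))
     = (\<lambda>v. fst v * F p + sint a (\<lambda>x. DF x (0, snd v)) p)"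
    unfolding ifx ftc[symmetric] by (simp add: sint_def pe g_def algebra_simps)
  moreover have "(\<lambda>x. fst x * integral (cbox a 1) (\<lambda>\<tau>. F (g \<tau> x))) = sint a F"
    by (auto simp: sint_def g_def)
  moreover have "at p within U = at p within SV"
    by (rule at_within_nhd[of _ "UNIV \<times> ball y r"]) (use r pe in \<open>auto simp: U_def open_Times\<close>)
  ultimately show ?thesis by (simp add: DF_def)
qed

text \<open>Removes the second term of \<open>has_derivative_sint\<close> in the direction (1, 0).
  The chosen derivative is known to be linear only on the strip, and \<tau> s stays inside
  it.\<close>

lemma sint_frechet_derivative_zero:
  assumes "F differentiable_on SV" "x \<in> SV"
  shows "sint a (\<lambda>x. frechet_derivative F (at x within SV) (0, 0)) x = 0"
proof -
  let ?D = "\<lambda>x. frechet_derivative F (at x within SV) (0, 0)"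
  have "?D (\<tau> * fst x, snd x) = 0" if "\<tau> \<in> {a..1}" for \<tau>
  proof -
    have "(\<tau> * fst x, snd x) \<in> SV"
      using assms(2) that a by (auto simp: mult_le_one)
    then have "linear (frechet_derivative F (at (\<tau> * fst x, snd x) within SV))"
      using assms(1) frechet_derivative_within_has_derivative has_derivative_linear by metis
    from linear_0[OF this] show ?thesis by (simp add: zero_prod_def)
  qed
  then have "integral {a..1} (\<lambda>\<tau>. ?D (\<tau> * fst x, snd x)) = integral {a..1} (\<lambda>\<tau>. 0)"
    by (intro integral_cong)
  then show ?thesis by (simp add: sint_def split_beta)
qed

lemma Ck_on_sint:
  assumes "a < b"
  shows "Ck_on k SV F \<Longrightarrow> (\<And>s y. 0 < s \<Longrightarrow> s < b \<Longrightarrow> s \<le> 1 \<Longrightarrow> y \<in> V \<Longrightarrow> F (s, y) = 0)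
    \<Longrightarrow> Ck_on k SV (sint a F)"
proof (induction k arbitrary: F)
  case 0
  then show ?case by (simp add: continuous_on_sint)
next
  case (Suc k)
  let ?D = "\<lambda>v x. frechet_derivative F (at x within SV) v"
  have F0: "F (s, y) = 0" if "0 < s" "s \<le> a" "y \<in> V" for s y
    using Suc.prems(2)[of s y] that assms a by auto
  have CD: "Ck_on k SV (?D v)" for v
    using Suc.prems(1) by (simp only: Ck_on.simps)
  have D0: "?D v (s, y) = 0" if "0 < s" "s < b" "s \<le> 1" "y \<in> V" for v s y
    using vanishing_frechet_derivative[of b F s y v] Suc.prems(2) that by simp
  have D: "Ck_on k SV (sint a (?D v))" for v
    using CD D0 by (intro Suc.IH)
  show ?case
  proof (rule Ck_on_SucI[OF axis_accessible_strip has_derivative_sint])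
    show "Ck_on k SV (\<lambda>x. fst v * F x + sint a (?D (0, snd v)) x)" for v
      using Ck_on_SucD[OF Suc.prems(1)] D
      by (intro Ck_on_add Ck_on_cmult axis_accessible_strip) auto
  qed (use Suc.prems(1) F0 Ck_on_imp_continuous_on[OF CD] in auto)
qed

text \<open>No constant is lost: a derivative in s returns F itself, a derivative in y moves under
  the integral, and integration over an interval of length at most 1 preserves the bound M.\<close>

lemma deriv_bound_sint:
  assumes "a < b" "W \<subseteq> V"
  shows "Ck_on k SV F \<Longrightarrow> (\<And>s y. 0 < s \<Longrightarrow> s < b \<Longrightarrow> s \<le> 1 \<Longrightarrow> y \<in> V \<Longrightarrow> F (s, y) = 0)
    \<Longrightarrow> deriv_bound SV ({0<..1} \<times> W) k F M \<Longrightarrow> deriv_bound SV ({0<..1} \<times> W) k (sint a F) M"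
proof (induction k arbitrary: F)
  case 0
  then show ?case by (auto simp: deriv_bound_0 intro!: sint_bound[OF a])
next
  case (Suc k)
  let ?T = "{0<..1} \<times> W"
  let ?D = "\<lambda>v x. frechet_derivative F (at x within SV) v"
  have F0: "F (s, y) = 0" if "0 < s" "s \<le> a" "y \<in> V" for s y
    using Suc.prems(2)[of s y] that assms a by auto
  have CD: "Ck_on k SV (?D v)" for v
    using Suc.prems(1) by (simp only: Ck_on.simps)
  have D0: "?D v (s, y) = 0" if "0 < s" "s < b" "s \<le> 1" "y \<in> V" for v s y
    using vanishing_frechet_derivative[of b F s y v] Suc.prems(2) that by simp
  show ?case
  proof (rule deriv_bound_SucI[OF axis_accessible_strip _ has_derivative_sint])
    fix v :: "real \<times> 'b" assume "v \<in> Basis"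
    then consider "v = (1, 0)" | e where "v = (0, e)" "e \<in> Basis"
      by (auto simp: Basis_prod_def)
    then show "deriv_bound SV ?T k (\<lambda>x. fst v * F x + sint a (?D (0, snd v)) x) M"
    proof cases
      case 1
      have "sint a (?D (0, 0)) x = 0" if "x \<in> SV" for x
        using Suc.prems(1) that by (intro sint_frechet_derivative_zero) auto
      then have "deriv_bound SV ?T k (\<lambda>x. fst v * F x + sint a (?D (0, snd v)) x) M
          \<longleftrightarrow> deriv_bound SV ?T k F M"
        using 1 assms by (intro deriv_bound_cong) auto
      then show ?thesis using Suc.prems(3) deriv_bound_SucD by blast
    next
      case 2
      have "deriv_bound SV ?T k (sint a (?D v)) M"
        using Suc.prems(3) \<open>v \<in> Basis\<close> by (intro Suc.IH CD D0) (auto simp: deriv_bound_Suc)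
      then show ?thesis using 2 by simp
    qed
  next
    show "\<bar>sint a F p\<bar> \<le> M" if p: "p \<in> ?T" for p
    proof -
      have "\<bar>F (s, snd p)\<bar> \<le> M" if "0 < s" "s \<le> 1" for s
        using p that deriv_bound_D0[OF Suc.prems(3), of "(s, snd p)"] by auto
      then show ?thesis
        using sint_bound[OF a, of F "snd p" M "fst p"] p by auto
    qed
  qed (use Suc.prems(1) F0 assms Ck_on_imp_continuous_on[OF CD] in auto)
qed

end

end

section \<open>Expansion in powers of \<open>\<delta> / r\<close>\<close>

text \<open>O(1) uniformly in the index. In the application an index is a triple (\<delta>, r0, x),
  so the constants obtained depend on the seed data and G''(0) only.\<close>

definition bdd_on :: "'i set \<Rightarrow> ('i \<Rightarrow> real) \<Rightarrow> bool" where
  "bdd_on X f \<longleftrightarrow> (\<exists>C. \<forall>i\<in>X. \<bar>f i\<bar> \<le> C)"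

lemma bdd_onI: "(\<And>i. i \<in> X \<Longrightarrow> \<bar>f i\<bar> \<le> C) \<Longrightarrow> bdd_on X f"
  by (auto simp: bdd_on_def)

lemma bdd_on_const: "bdd_on X (\<lambda>i. c)"
  by (auto simp: bdd_on_def)

lemma bdd_on_add: "bdd_on X f \<Longrightarrow> bdd_on X g \<Longrightarrow> bdd_on X (\<lambda>i. f i + g i)"
  unfolding bdd_on_def by (meson abs_triangle_ineq add_mono order_trans)

lemma bdd_on_minus: "bdd_on X f \<Longrightarrow> bdd_on X (\<lambda>i. - f i)"
  by (simp add: bdd_on_def)

lemma bdd_on_diff: "bdd_on X f \<Longrightarrow> bdd_on X g \<Longrightarrow> bdd_on X (\<lambda>i. f i - g i)"
  using bdd_on_add[OF _ bdd_on_minus] by fastforce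

lemma bdd_on_mult:
  assumes "bdd_on X f" "bdd_on X g"
  shows "bdd_on X (\<lambda>i. f i * g i)"
proof -
  obtain C D where "\<forall>i\<in>X. \<bar>f i\<bar> \<le> C" "\<forall>i\<in>X. \<bar>g i\<bar> \<le> D"
    using assms by (auto simp: bdd_on_def)
  then show ?thesis
    by (intro bdd_onI[of _ _ "\<bar>C\<bar> * \<bar>D\<bar>"]) (force simp: abs_mult intro!: mult_mono)
qed

lemma bdd_on_power: "bdd_on X f \<Longrightarrow> bdd_on X (\<lambda>i. f i ^ n)"
  by (induction n) (auto intro: bdd_on_const bdd_on_mult)

lemmas bdd_on_intros = bdd_on_const bdd_on_add bdd_on_minus bdd_on_diff bdd_on_mult bdd_on_power

text \<open>The algebraic core, free of u. The dictionary is a = \<phi>1, b its s-derivative, J = I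
  \<phi>1, w and z the first and second s-derivatives of \<phi>0, q the angular part of the
  Laplacian, E the rescaled Laplacian, R = |x|, and 1 + h = 1 / c^2. The two estimated expressions
  are the rescaled first and second application of \<open>Lbar\<close>.\<close>

lemma short_pulse_expansion:
  fixes a b J q \<delta> r R c :: "'i \<Rightarrow> real" and G :: real
  defines "h \<equiv> \<lambda>i. 3 * G * (\<delta> i / (r i)\<^sup>2) * (a i)\<^sup>2"
  defines "w \<equiv> \<lambda>i. a i + G / 2 * (\<delta> i / (r i)\<^sup>2) * a i ^ 3 - \<delta> i / r i * J i"
    and "z \<equiv> \<lambda>i. b i + 3 / 2 * G * (\<delta> i / (r i)\<^sup>2) * (a i)\<^sup>2 * b i - \<delta> i / r i * a i"
  defines "E \<equiv> \<lambda>i. z i + 2 * \<delta> i / R i * w i + (\<delta> i / R i)\<^sup>2 * q i"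
  assumes bdd: "bdd_on X a" "bdd_on X b" "bdd_on X J" "bdd_on X q"
    and X: "\<And>i. i \<in> X \<Longrightarrow> 0 < \<delta> i \<and> \<delta> i < 1 \<and> 2 < r i \<and> r i < R i \<and> R i < r i + \<delta> i"
    and h: "\<And>i. i \<in> X \<Longrightarrow> \<bar>h i\<bar> \<le> 1 / 2"
    and c: "\<And>i. i \<in> X \<Longrightarrow> 0 < c i \<and> (c i)\<^sup>2 * (1 + h i) = 1"
  shows "\<exists>C. \<forall>i\<in>X. \<bar>a i - c i * w i\<bar> \<le> C * (\<delta> i / r i) \<and>
    \<bar>(c i)\<^sup>2 * (E i + z i) + 3 * G * (\<delta> i / (r i)\<^sup>2) * c i ^ 5 * a i * w i * E i
      - 2 * c i * b i - 3 * G * (\<delta> i / (r i)\<^sup>2) * c i ^ 4 * a i * w i * b i\<bar> \<le> C * (\<delta> i / r i)\<^sup>2"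
proof -
  \<comment> \<open>The suffix 1 marks a deviation divided by \<epsilon>: h = \<epsilon> h1, c = 1 +
    \<epsilon> c1, w = a + \<epsilon> w1, z = b + \<epsilon> z1, E = b + \<epsilon> E1. Moreover c =
    1 - h / 2 + \<epsilon>^2 \<rho>, and \<delta> / R = \<epsilon> (1 + \<epsilon> e1) measures the
    cost of replacing R by r. The second expression will be \<epsilon>^2 c P.\<close>
  define \<epsilon> where "\<epsilon> i = \<delta> i / r i" for i
  define k where "k i = 1 / r i" for i
  define h1 where "h1 i = 3 * G * k i * (a i)\<^sup>2" for i
  define ic where "ic i = 1 / (1 + c i)" for i
  define c1 where "c1 i = - h1 i * (c i)\<^sup>2 * ic i" for i
  define \<rho> where "\<rho> i = - h1 i * c1 i * (1 + 2 * c i) * ic i / 2" for i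
  define w1 where "w1 i = G / 2 * k i * a i ^ 3 - J i" for i
  define z1 where "z1 i = h1 i * b i / 2 - a i" for i
  define e1 where "e1 i = (r i - R i) * r i / (R i * \<delta> i)" for i
  define e2 where "e2 i = (r i / R i)\<^sup>2" for i
  define E1 where "E1 i = z1 i + 2 * (1 + \<epsilon> i * e1 i) * w i + \<epsilon> i * e2 i * q i" for i
  define P where "P i = 2 * b i * (\<rho> i * (1 + h i / 2) - (h1 i)\<^sup>2 / 4)
      + c i * (2 * w1 i + 2 * w i * e1 i + q i * e2 i)
      + 3 * G * k i * a i * w i * c i ^ 3 * (c1 i * E i + E1 i)" for i
  have \<epsilon>: "bdd_on X \<epsilon>" by (rule bdd_onI[of _ _ 1]) (use X in \<open>force simp: \<epsilon>_def\<close>)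
  have k: "bdd_on X k" by (rule bdd_onI[of _ _ 1]) (use X in \<open>force simp: k_def\<close>)
  have e1: "bdd_on X e1"
  proof (rule bdd_onI[of _ _ 1])
    fix i assume "i \<in> X"
    note Xi = X[OF this]
    have "\<bar>(r i - R i) * r i\<bar> \<le> \<delta> i * R i" unfolding abs_mult using Xi by (intro mult_mono) auto
    then show "\<bar>e1 i\<bar> \<le> 1" using Xi by (simp add: e1_def abs_mult mult.commute)
  qed
  have e2: "bdd_on X e2"
    by (rule bdd_onI[of _ _ 1]) (use X in \<open>force simp: e2_def power_le_one\<close>)
  have cb: "bdd_on X c"
  proof (rule bdd_onI[of _ _ 2])
    fix i assume i: "i \<in> X"
    have "1 / 2 \<le> 1 + h i" using h[OF i] by linarith
    then have "(c i)\<^sup>2 * (1 / 2) \<le> (c i)\<^sup>2 * (1 + h i)" by (intro mult_left_mono) auto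
    then have "(c i)\<^sup>2 \<le> 2\<^sup>2" using c[OF i] by simp
    then have "c i \<le> 2" by (rule power2_le_imp_le) simp
    then show "\<bar>c i\<bar> \<le> 2" using c[OF i] by simp
  qed
  have icb: "bdd_on X ic" by (rule bdd_onI[of _ _ 1]) (use c in \<open>force simp: ic_def\<close>)
  have eps: "\<delta> i / r i = \<epsilon> i" "\<delta> i / (r i)\<^sup>2 = \<epsilon> i * k i" for i
    by (simp_all add: \<epsilon>_def k_def power2_eq_square)
  have h_eq: "h i = \<epsilon> i * h1 i" and w_eq: "w i = a i + \<epsilon> i * w1 i" for i
    by (simp_all add: h_def w_def eps h1_def w1_def algebra_simps)
  have z_eq: "z i = b i + \<epsilon> i * z1 i" for i
    by (simp add: z_def eps z1_def h1_def algebra_simps)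
  have hb: "bdd_on X h1" "bdd_on X h"
    unfolding h_eq[abs_def] unfolding h1_def by (intro bdd_on_intros bdd k \<epsilon>)+
  have c1b: "bdd_on X c1" unfolding c1_def by (intro bdd_on_intros hb cb icb)
  have \<rho>b: "bdd_on X \<rho>"
    unfolding \<rho>_def divide_inverse by (intro bdd_on_intros hb c1b cb icb)
  have wb: "bdd_on X w1" "bdd_on X w"
    unfolding w_eq[abs_def] unfolding w1_def by (intro bdd_on_intros bdd k \<epsilon>)+
  have zb: "bdd_on X z1" "bdd_on X z"
    unfolding z_eq[abs_def] unfolding z1_def divide_inverse by (intro bdd_on_intros bdd hb \<epsilon>)+
  have E_eq: "E i = b i + \<epsilon> i * E1 i" if "i \<in> X" for i
  proof -
    have "2 * \<delta> i / R i = 2 * (\<epsilon> i * (1 + \<epsilon> i * e1 i))" "(\<delta> i / R i)\<^sup>2 = (\<epsilon> i)\<^sup>2 * e2 i"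
      using X[OF that] by (simp_all add: \<epsilon>_def e1_def e2_def field_simps)
    then show ?thesis
      unfolding E_def E1_def z_eq by (simp only:) (simp add: algebra_simps power2_eq_square)
  qed
  have c_eq: "c i = 1 + \<epsilon> i * c1 i" if "i \<in> X" for i
  proof -
    \<comment> \<open>Factoring c^2 (1 + h) = 1 replaces a Taylor expansion of the power -1/2;
      dividing by 1 + c > 1 is harmless. The second-order version below repeats this with 1 + c - 2
      c^2 = (1 - c) (1 + 2 c).\<close>
    have "(c i - 1) * (1 + c i) = - h i * (c i)\<^sup>2"
      using c[OF that] by (simp add: algebra_simps power2_eq_square)
    moreover have "c i - 1 = (c i - 1) * (1 + c i) * ic i"
      using c[OF that] by (simp add: ic_def)
    ultimately have "c i - 1 = - h i * (c i)\<^sup>2 * ic i" by simp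
    then show ?thesis by (simp add: c1_def h_eq algebra_simps)
  qed
  have c_eq2: "c i = 1 - h i / 2 + (\<epsilon> i)\<^sup>2 * \<rho> i" if i: "i \<in> X" for i
  proof -
    have ic: "ic i * (1 + c i) = 1" using c[OF i] by (simp add: ic_def)
    have "c i - 1 + h i / 2 = h i * ((1 + c i - 2 * (c i)\<^sup>2) * ic i) / 2"
    proof -
      have "c i - 1 = - h i * (c i)\<^sup>2 * ic i" using c_eq[OF i] by (simp add: c1_def h_eq)
      moreover have "h i / 2 = h i * (ic i * (1 + c i)) / 2" using ic by simp
      ultimately show ?thesis by (simp add: algebra_simps)
    qed
    also have "1 + c i - 2 * (c i)\<^sup>2 = - (\<epsilon> i * c1 i) * (1 + 2 * c i)"
      using c_eq[OF i] by (simp add: algebra_simps power2_eq_square)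
    finally have "c i = 1 - h i / 2 + h i * (- (\<epsilon> i * c1 i) * (1 + 2 * c i) * ic i) / 2" by simp
    also have "h i * (- (\<epsilon> i * c1 i) * (1 + 2 * c i) * ic i) / 2 = (\<epsilon> i)\<^sup>2 * \<rho> i"
      by (simp add: \<rho>_def h_eq power2_eq_square)
    finally show ?thesis .
  qed
  have Eb: "bdd_on X E1" "bdd_on X E"
  proof -
    show E1: "bdd_on X E1" unfolding E1_def by (intro bdd_on_intros bdd zb wb \<epsilon> e1 e2)
    have "bdd_on X (\<lambda>i. b i + \<epsilon> i * E1 i)" by (intro bdd_on_intros bdd \<epsilon> E1)
    then show "bdd_on X E" unfolding bdd_on_def using E_eq by metis
  qed
  have Pb: "bdd_on X P"
    unfolding P_def divide_inverse
    by (intro bdd_on_intros bdd \<rho>b hb cb c1b wb zb Eb e1 e2 k)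
  have "bdd_on X (\<lambda>i. w1 i + c1 i * w i)" "bdd_on X (\<lambda>i. c i * P i)"
    by (intro bdd_on_intros wb c1b cb Pb)+
  then obtain C1 C2 where C: "\<And>i. i \<in> X \<Longrightarrow> \<bar>w1 i + c1 i * w i\<bar> \<le> C1"
    "\<And>i. i \<in> X \<Longrightarrow> \<bar>c i * P i\<bar> \<le> C2" unfolding bdd_on_def by blast
  show ?thesis
  proof (intro exI[of _ "max C1 C2"] ballI conjI)
    fix i assume i: "i \<in> X"
    have pos: "0 < \<epsilon> i" using X[OF i] by (simp add: \<epsilon>_def)
    have "a i - c i * w i = - \<epsilon> i * (w1 i + c1 i * w i)"
      using c_eq[OF i] w_eq[of i] by (simp add: algebra_simps)
    then have "\<bar>a i - c i * w i\<bar> = \<bar>w1 i + c1 i * w i\<bar> * \<epsilon> i"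
      using pos by (simp add: abs_mult)
    also have "\<dots> \<le> max C1 C2 * \<epsilon> i" using pos C(1)[OF i] by (intro mult_right_mono) auto
    finally show "\<bar>a i - c i * w i\<bar> \<le> max C1 C2 * (\<delta> i / r i)" by (simp add: \<epsilon>_def)
    let ?L = "(c i)\<^sup>2 * (E i + z i) + 3 * G * (\<delta> i / (r i)\<^sup>2) * c i ^ 5 * a i * w i * E i
      - 2 * c i * b i - 3 * G * (\<delta> i / (r i)\<^sup>2) * c i ^ 4 * a i * w i * b i"
    have "?L = (\<epsilon> i)\<^sup>2 * (c i * P i)"
    proof -
      \<comment> \<open>The two nonlinear terms already carry the small factor \<delta> / r^2 =
        \<epsilon> k, so it is enough that their difference, proportional to c E - b, vanishes to
        first order.\<close>
      have cE: "c i * E i - b i = \<epsilon> i * (c1 i * E i + E1 i)"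
        using c_eq[OF i] E_eq[OF i] by (simp add: algebra_simps)
      have Ez: "E i + z i = b i * (2 + h i)
          + (\<epsilon> i)\<^sup>2 * (2 * w1 i + 2 * w i * e1 i + q i * e2 i)"
        unfolding E_eq[OF i] E1_def z_eq z1_def h_eq
        by (simp add: w_eq[of i] algebra_simps power2_eq_square)
      \<comment> \<open>(1 - h / 2) (2 + h) = 2 - h^2 / 2 has no term linear in h; the factor 2 + h
        is produced by the cubic term of the profile.\<close>
      have ch: "c i * (2 + h i) = 2 + 2 * (\<epsilon> i)\<^sup>2 * (\<rho> i * (1 + h i / 2) - (h1 i)\<^sup>2 / 4)"
        unfolding c_eq2[OF i] h_eq by (simp add: field_simps power2_eq_square)
      have "c i * (E i + z i) = b i * (c i * (2 + h i))
          + (\<epsilon> i)\<^sup>2 * c i * (2 * w1 i + 2 * w i * e1 i + q i * e2 i)"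
        unfolding Ez by (simp add: algebra_simps)
      then have cEz: "c i * (E i + z i) - 2 * b i = (\<epsilon> i)\<^sup>2 *
          (2 * b i * (\<rho> i * (1 + h i / 2) - (h1 i)\<^sup>2 / 4)
          + c i * (2 * w1 i + 2 * w i * e1 i + q i * e2 i))"
        unfolding ch by (simp add: algebra_simps)
      have "?L = c i * (c i * (E i + z i) - 2 * b i)
          + 3 * G * (\<epsilon> i * k i) * c i ^ 4 * a i * w i * (c i * E i - b i)"
        unfolding eps by (simp add: algebra_simps power2_eq_square eval_nat_numeral)
      also have "\<dots> = (\<epsilon> i)\<^sup>2 * (c i * P i)"
        unfolding cEz cE P_def by (simp add: algebra_simps power2_eq_square eval_nat_numeral)
      finally show ?thesis .
    qed
    then have "\<bar>?L\<bar> = \<bar>c i * P i\<bar> * (\<epsilon> i)\<^sup>2" by (simp add: abs_mult)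
    also have "\<dots> \<le> max C1 C2 * (\<epsilon> i)\<^sup>2" using C(2)[OF i] by (intro mult_right_mono) auto
    finally show "\<bar>?L\<bar> \<le> max C1 C2 * (\<delta> i / r i)\<^sup>2" by (simp add: \<epsilon>_def)
  qed
qed

section \<open>Second derivatives of u on the initial slice\<close>

lemma frechet_derivative_along_line:
  assumes "f differentiable at (q + s *\<^sub>R e)"
  shows "((\<lambda>t. f (q + t *\<^sub>R e)) has_real_derivative frechet_derivative f (at (q + s *\<^sub>R e)) e) (at s)"
proof -
  have f: "(f has_derivative frechet_derivative f (at (q + s *\<^sub>R e))) (at (q + s *\<^sub>R e))"
    using assms by (simp add: frechet_derivative_works[symmetric])
  have "((\<lambda>t. q + t *\<^sub>R e) has_derivative (\<lambda>t. t *\<^sub>R e)) (at s)"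
    by (auto intro!: derivative_eq_intros)
  from has_derivative_compose[OF this f] show ?thesis
    by (rule has_derivative_imp_has_field_derivative)
      (simp add: linear_scale[OF linear_frechet_derivative[OF assms]])
qed

lemmas frechet_derivative_line = frechet_derivative_along_line[where s = 0, simplified]

text \<open>The mean value theorem twice: first in the direction v for a difference of u between two
  parallel segments, then in the direction w for the derivative along v.\<close>

lemma second_difference_mvt:
  fixes u :: "'a::real_normed_vector \<Rightarrow> real"
  assumes h: "0 < h"
    and U: "\<And>s t. 0 \<le> s \<Longrightarrow> s \<le> h \<Longrightarrow> 0 \<le> t \<Longrightarrow> t \<le> h \<Longrightarrow> p + s *\<^sub>R v + t *\<^sub>R w \<in> U"
    and u: "\<And>x. x \<in> U \<Longrightarrow> u differentiable at x"
    and Du: "\<And>x. x \<in> U \<Longrightarrow> (\<lambda>y. frechet_derivative u (at y) v) differentiable at x"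
  shows "\<exists>s t. 0 \<le> s \<and> s \<le> h \<and> 0 \<le> t \<and> t \<le> h \<and>
    u (p + h *\<^sub>R v + h *\<^sub>R w) - u (p + h *\<^sub>R v) - u (p + h *\<^sub>R w) + u p =
      h\<^sup>2 * frechet_derivative (\<lambda>y. frechet_derivative u (at y) v) (at (p + s *\<^sub>R v + t *\<^sub>R w)) w"
proof -
  note chain = frechet_derivative_along_line
  let ?D = "\<lambda>y. frechet_derivative u (at y) v"
  let ?\<phi> = "\<lambda>s. u (p + h *\<^sub>R w + s *\<^sub>R v) - u (p + s *\<^sub>R v)"
  have "\<exists>s>0. s < h \<and> ?\<phi> h - ?\<phi> 0 = (h - 0) * (?D (p + h *\<^sub>R w + s *\<^sub>R v) - ?D (p + s *\<^sub>R v))"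
  proof (rule MVT2[OF h])
    fix s assume "0 \<le> s" "s \<le> h"
    then have "p + h *\<^sub>R w + s *\<^sub>R v \<in> U" "p + s *\<^sub>R v \<in> U"
      using U[of s h] U[of s 0] h by (simp_all add: ac_simps)
    then show "(?\<phi> has_real_derivative ?D (p + h *\<^sub>R w + s *\<^sub>R v) - ?D (p + s *\<^sub>R v)) (at s)"
      by (intro DERIV_diff chain u)
  qed
  then obtain s where s: "0 < s" "s < h"
    "?\<phi> h - ?\<phi> 0 = h * (?D (p + h *\<^sub>R w + s *\<^sub>R v) - ?D (p + s *\<^sub>R v))" by auto
  let ?\<psi> = "\<lambda>t. ?D (p + s *\<^sub>R v + t *\<^sub>R w)"
  have "\<exists>t>0. t < h \<and> ?\<psi> h - ?\<psi> 0 = (h - 0) * frechet_derivative ?D (at (p + s *\<^sub>R v + t *\<^sub>R w)) w"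
    by (rule MVT2[OF h chain[OF Du[OF U]]]) (use s in auto)
  then obtain t where "0 < t" "t < h"
    "?\<psi> h - ?\<psi> 0 = h * frechet_derivative ?D (at (p + s *\<^sub>R v + t *\<^sub>R w)) w" by auto
  with s show ?thesis
    by (intro exI[of _ s] exI[of _ t]) (simp add: algebra_simps power2_eq_square)
qed

text \<open>The second difference is symmetric in v and w, so \<open>second_difference_mvt\<close>
  equates the two mixed derivatives at two points of a small parallelogram at p. Continuity carries
  this to p.\<close>

lemma mixed_partials_eq:
  fixes u :: "'a::real_normed_vector \<Rightarrow> real"
  assumes U: "open U" "p \<in> U"
    and u: "\<And>x. x \<in> U \<Longrightarrow> u differentiable at x"
    and Du: "\<And>x e. x \<in> U \<Longrightarrow> (\<lambda>y. frechet_derivative u (at y) e) differentiable at x"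
    and cont: "\<And>e e'. continuous_on U (\<lambda>x. frechet_derivative (\<lambda>y. frechet_derivative u (at y) e) (at x) e')"
  shows "frechet_derivative (\<lambda>y. frechet_derivative u (at y) v) (at p) w =
    frechet_derivative (\<lambda>y. frechet_derivative u (at y) w) (at p) v"
proof -
  define Q where "Q e e' x = frechet_derivative (\<lambda>y. frechet_derivative u (at y) e) (at x) e'" for e e' x
  have "\<bar>Q v w p - Q w v p\<bar> \<le> \<eta>" if \<eta>: "0 < \<eta>" for \<eta>
  proof -
    have near: "\<exists>d>0. \<forall>x\<in>U. dist x p < d \<longrightarrow> dist (Q e e' x) (Q e e' p) < \<eta> / 2" for e e'
      using cont[of e e'] U \<eta> unfolding continuous_on_iff Q_def by (meson half_gt_zero)
    obtain d1 d2 d3 where d: "d1 > 0" "d2 > 0" "d3 > 0" "ball p d3 \<subseteq> U"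
      "\<And>x. x \<in> U \<Longrightarrow> dist x p < d1 \<Longrightarrow> dist (Q v w x) (Q v w p) < \<eta> / 2"
      "\<And>x. x \<in> U \<Longrightarrow> dist x p < d2 \<Longrightarrow> dist (Q w v x) (Q w v p) < \<eta> / 2"
      using near U openE by metis
    define d where "d = min d1 (min d2 d3)"
    define n where "n = norm v + norm w + 1"
    \<comment> \<open>Chosen so that h n = d / 2; the summand 1 in n keeps the quotient meaningful
      when v = w = 0.\<close>
    define h where "h = d / 2 / n"
    have n: "0 < n" by (simp add: n_def add_nonneg_pos)
    have d0: "0 < d" using d by (simp add: d_def)
    then have h: "0 < h" using n by (simp add: h_def)
    have small: "dist (p + s *\<^sub>R v + t *\<^sub>R w) p < d" if "0 \<le> s" "s \<le> h" "0 \<le> t" "t \<le> h" for s t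
    proof -
      have "dist (p + s *\<^sub>R v + t *\<^sub>R w) p \<le> s * norm v + t * norm w"
        using that norm_triangle_ineq[of "s *\<^sub>R v" "t *\<^sub>R w"] by (simp add: dist_norm)
      also have "\<dots> \<le> h * norm v + h * norm w" using that by (intro add_mono mult_right_mono) auto
      also have "\<dots> \<le> h * n" using h by (simp add: n_def algebra_simps)
      also have "\<dots> = d / 2" using n by (simp add: h_def)
      also have "\<dots> < d" using d0 by simp
      finally show ?thesis .
    qed
    have inU: "p + s *\<^sub>R v + t *\<^sub>R w \<in> U" if "0 \<le> s" "s \<le> h" "0 \<le> t" "t \<le> h" for s t
      using small[OF that] d by (auto simp: d_def dist_commute)
    obtain s t where st: "0 \<le> s" "s \<le> h" "0 \<le> t" "t \<le> h"
      "u (p + h *\<^sub>R v + h *\<^sub>R w) - u (p + h *\<^sub>R v) - u (p + h *\<^sub>R w) + u p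
        = h\<^sup>2 * Q v w (p + s *\<^sub>R v + t *\<^sub>R w)"
      using second_difference_mvt[OF h inU u Du] unfolding Q_def by blast
    have inU': "p + s *\<^sub>R w + t *\<^sub>R v \<in> U" if "0 \<le> s" "s \<le> h" "0 \<le> t" "t \<le> h" for s t
      using inU[of t s] that by (simp add: ac_simps)
    obtain s' t' where st': "0 \<le> s'" "s' \<le> h" "0 \<le> t'" "t' \<le> h"
      "u (p + h *\<^sub>R w + h *\<^sub>R v) - u (p + h *\<^sub>R w) - u (p + h *\<^sub>R v) + u p
        = h\<^sup>2 * Q w v (p + s' *\<^sub>R w + t' *\<^sub>R v)"
      using second_difference_mvt[OF h inU' u Du] unfolding Q_def by blast
    have swap: "p + s *\<^sub>R w + t *\<^sub>R v = p + t *\<^sub>R v + s *\<^sub>R w" for s t by (simp add: ac_simps)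
    have "h\<^sup>2 * Q v w (p + s *\<^sub>R v + t *\<^sub>R w) = h\<^sup>2 * Q w v (p + t' *\<^sub>R v + s' *\<^sub>R w)"
      using st(5) st'(5) unfolding swap[of h h] swap[of s' t'] by linarith
    then have eq: "Q v w (p + s *\<^sub>R v + t *\<^sub>R w) = Q w v (p + t' *\<^sub>R v + s' *\<^sub>R w)"
      using h by simp
    have "dist (Q v w (p + s *\<^sub>R v + t *\<^sub>R w)) (Q v w p) < \<eta> / 2"
      using small[OF st(1-4)] inU[OF st(1-4)] by (intro d(5)) (auto simp: d_def)
    moreover have "dist (Q w v (p + t' *\<^sub>R v + s' *\<^sub>R w)) (Q w v p) < \<eta> / 2"
      using small[OF st'(3,4,1,2)] inU[OF st'(3,4,1,2)] by (intro d(6)) (auto simp: d_def)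
    ultimately show ?thesis using eq unfolding dist_real_def by linarith
  qed
  then have "\<bar>Q v w p - Q w v p\<bar> \<le> 0" by (rule field_le_epsilon) simp
  then show ?thesis by (simp add: Q_def)
qed

text \<open>The function is controlled on the open annulus only. The two spheres are null sets,
  hence invisible to the essential supremum, and by completeness of Lebesgue measure arbitrary
  values on them do not affect measurability.\<close>

lemma Linf_norm_annulus_le:
  assumes f: "continuous_on {x. r < norm x \<and> norm x < r + \<delta>} f"
    and K: "\<And>x. r < norm x \<Longrightarrow> norm x < r + \<delta> \<Longrightarrow> \<bar>f x\<bar> \<le> K"
  shows "Linf_norm (annulus r \<delta>) f \<le> ereal K"
proof -
  let ?A = "{x :: real^3. r < norm x \<and> norm x < r + \<delta>}"
  let ?N = "sphere (0 :: real^3) r \<union> sphere 0 (r + \<delta>)"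
  have "open ?A" by (intro open_Collect_conj open_Collect_less continuous_intros)
  then have A: "?A \<in> sets lebesgue" by simp
  have "closed (annulus r \<delta>)"
    unfolding annulus_def by (intro closed_Collect_conj closed_Collect_le continuous_intros)
  then have ann: "annulus r \<delta> \<in> sets lebesgue" by simp
  have cover: "annulus r \<delta> \<subseteq> ?A \<union> ?N" by (auto simp: annulus_def)
  have N: "negligible ?N" by (intro negligible_Un negligible_sphere)
  have "f \<in> borel_measurable (lebesgue_on ?A)"
    using f A by (rule continuous_imp_measurable_on_sets_lebesgue)
  then have g: "(\<lambda>x. if x \<in> ?A then f x else 0) \<in> borel_measurable lebesgue" (is "?g \<in> _")
    using A by (rule borel_measurable_if_I)
  have "f \<in> borel_measurable (lebesgue_on (annulus r \<delta>))"
  proof (rule measurableI)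
    fix B :: "real set" assume B: "B \<in> sets borel"
    have "f -` B \<inter> annulus r \<delta> = (?g -` B \<inter> ?A \<inter> annulus r \<delta>) \<union> (f -` B \<inter> (annulus r \<delta> \<inter> ?N) - ?A)"
      using cover by auto
    moreover have "?g -` B \<inter> ?A \<inter> annulus r \<delta> \<in> sets lebesgue"
      using measurable_sets[OF g B] A ann by (intro sets.Int) simp_all
    moreover have "f -` B \<inter> (annulus r \<delta> \<inter> ?N) - ?A \<in> sets lebesgue"
      by (intro negligible_imp_sets negligible_subset[OF N]) auto
    ultimately show "f -` B \<inter> space (lebesgue_on (annulus r \<delta>)) \<in> sets (lebesgue_on (annulus r \<delta>))"
      using ann by (auto simp: sets_restrict_space_iff)
  qed auto
  then have "(\<lambda>x. ereal \<bar>f x\<bar>) \<in> borel_measurable (lebesgue_on (annulus r \<delta>))" by simp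
  moreover have "AE x in lebesgue_on (annulus r \<delta>). ereal \<bar>f x\<bar> \<le> ereal K"
  proof -
    have "AE x in lebesgue. x \<notin> ?N"
      using N by (intro AE_not_in) (simp add: negligible_iff_null_sets)
    then have "AE x in lebesgue. x \<in> annulus r \<delta> \<longrightarrow> ereal \<bar>f x\<bar> \<le> ereal K"
      by eventually_elim (use cover K in auto)
    then show ?thesis using ann by (simp add: AE_restrict_space_iff)
  qed
  ultimately show ?thesis unfolding Linf_norm_def by (rule esssup_I)
qed

section \<open>Second derivatives of a C^2 function and the expansion of two applications of
  \<open>Lbar\<close>\<close>

lemma Ck_on_2_open:
  assumes "open U" "Ck_on 2 U u"
  shows "x \<in> U \<Longrightarrow> u differentiable at x"
    and "x \<in> U \<Longrightarrow> (\<lambda>y. frechet_derivative u (at y) v) differentiable at x"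
    and "continuous_on U (\<lambda>x. frechet_derivative (\<lambda>y. frechet_derivative u (at y) v) (at x) w)"
proof -
  let ?D = "\<lambda>v x. frechet_derivative u (at x within U) v"
  have "Ck_on (Suc (Suc 0)) U u" using assms(2) by (simp only: numeral_2_eq_2)
  note u1 = Ck_on_Suc_differentiable[OF this] and u2 = Ck_on_Suc_differentiable[OF Ck_on_Suc_deriv[OF this]]
    and u3 = Ck_on_Suc_deriv[OF Ck_on_Suc_deriv[OF this], unfolded Ck_on.simps(1)]
  show "x \<in> U \<Longrightarrow> u differentiable at x"
    using u1 assms(1) by (simp add: differentiable_on_eq_differentiable_at)
  have within: "at x within U = at x" if "x \<in> U" for x
    using that assms(1) by (rule at_within_open)
  show "(\<lambda>y. frechet_derivative u (at y) v) differentiable at x" if x: "x \<in> U"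
  proof -
    obtain f' where "(?D v has_derivative f') (at x within U)"
      using u2[of v] x by (auto simp: differentiable_on_def differentiable_def)
    then have "((\<lambda>y. frechet_derivative u (at y) v) has_derivative f') (at x within U)"
      by (rule has_derivative_transform[rotated 2]) (use x within in auto)
    then show ?thesis using within[OF x] by (auto simp: differentiable_def)
  qed
  show "continuous_on U (\<lambda>x. frechet_derivative (\<lambda>y. frechet_derivative u (at y) v) (at x) w)"
  proof (rule continuous_on_eq[OF u3[of v w]])
    fix x assume x: "x \<in> U"
    have "frechet_derivative (?D v) (at x within U)
        = frechet_derivative (\<lambda>y. frechet_derivative u (at y) v) (at x within U)"
      using x by (intro frechet_derivative_within_cong) (auto simp: within)
    then show "frechet_derivative (?D v) (at x within U) w
        = frechet_derivative (\<lambda>y. frechet_derivative u (at y) v) (at x) w"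
      using within[OF x] by simp
  qed
qed

text \<open>The line stays in a slice of constant t, so spatial derivatives at t = -r0 can be read
  off from the data alone.\<close>

lemma dx_eqI:
  assumes "f differentiable at (t, x)" "((\<lambda>s. f (t, x + s *\<^sub>R e)) has_real_derivative d) (at 0)"
  shows "dx e f (t, x) = d"
proof (rule DERIV_unique)
  show "((\<lambda>s. f (t, x + s *\<^sub>R e)) has_real_derivative dx e f (t, x)) (at 0)"
    using frechet_derivative_line[OF assms(1), of "(0, e)"] by (simp add: dx_def)
qed (rule assms(2))

lemma dt_eqI:
  assumes "f differentiable at (t, x)" "((\<lambda>s. f (t + s, x)) has_real_derivative d) (at 0)"
  shows "dt f (t, x) = d"
proof (rule DERIV_unique)
  show "((\<lambda>s. f (t + s, x)) has_real_derivative dt f (t, x)) (at 0)"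
    using frechet_derivative_line[OF assms(1), of "(1, 0)"] by (simp add: dt_def)
qed (rule assms(2))

lemma frechet_derivative_eqI_at:
  "(f has_derivative f') (at p) \<Longrightarrow> frechet_derivative f (at p) v = f' v"
  using frechet_derivative_at by metis

text \<open>The direction x / |x| varies with the point. Expanding it in the basis leaves a finite
  sum of differentiable coefficients times derivatives in fixed directions.\<close>

lemma dr_differentiable:
  assumes "open U" "p \<in> U" "snd p \<noteq> 0"
    and u: "\<And>q. q \<in> U \<Longrightarrow> u differentiable at q"
    and Du: "\<And>e. (\<lambda>q. frechet_derivative u (at q) e) differentiable at p"
  shows "dr u differentiable at p"
proof -
  let ?g = "\<lambda>q. \<Sum>b\<in>Basis. (snd q \<bullet> b / norm (snd q)) * frechet_derivative u (at q) (0, b)"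
  have "?g differentiable at p"
    by (intro differentiable_sum finite_Basis ballI differentiable_mult Du differentiable_divide
        differentiable_inner differentiable_const differentiable_compose[OF differentiable_norm_at]
        bounded_linear_imp_differentiable bounded_linear_snd)
      (use assms in auto)
  then obtain g' where g': "(?g has_derivative g') (at p)" by (auto simp: differentiable_def)
  have "(dr u has_derivative g') (at p)"
  proof (rule has_derivative_transform_within_open[OF g' assms(1,2)])
    fix q assume q: "q \<in> U"
    have lin: "linear (frechet_derivative u (at q))" using u[OF q] by (rule linear_frechet_derivative)
    have e: "(0, snd q /\<^sub>R norm (snd q)) = (\<Sum>b\<in>Basis. (snd q \<bullet> b / norm (snd q)) *\<^sub>R (0 :: real, b))"
    proof -
      have "(\<Sum>b\<in>Basis. (snd q \<bullet> b / norm (snd q)) *\<^sub>R b) = snd q /\<^sub>R norm (snd q)"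
        using euclidean_representation[of "snd q /\<^sub>R norm (snd q)"] by (simp add: divide_inverse mult.commute)
      then show ?thesis
        by (simp add: prod_eq_iff fst_sum snd_sum)
    qed
    have "dr u q = frechet_derivative u (at q) (0, snd q /\<^sub>R norm (snd q))"
      by (simp add: dr_def dx_def)
    also have "\<dots> = ?g q"
      unfolding e linear_sum[OF lin] linear_scale[OF lin] by simp
    finally show "?g q = dr u q" by simp
  qed
  then show ?thesis by (auto simp: differentiable_def)
qed

text \<open>The radial direction does not depend on t, so it may be frozen at x and the symmetry of
  mixed derivatives in fixed directions applies.\<close>

lemma dt_dr_commute:
  assumes U: "open U" "(t, x) \<in> U" "Ck_on 2 U u" and x: "x \<noteq> 0"
  shows "dt (dr u) (t, x) = dr (dt u) (t, x)"
proof -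
  note u = Ck_on_2_open[OF U(1,3)]
  let ?D = "\<lambda>q. frechet_derivative u (at q) (0, x /\<^sub>R norm x)"
  have "dr u differentiable at (t, x)"
    by (rule dr_differentiable[OF U(1,2) _ u(1,2)]) (use x U in auto)
  then have "dt (dr u) (t, x) = frechet_derivative ?D (at (t, x)) (1, 0)"
  proof (rule dt_eqI)
    show "((\<lambda>s. dr u (t + s, x)) has_real_derivative frechet_derivative ?D (at (t, x)) (1, 0)) (at 0)"
      using frechet_derivative_line[OF u(2)[OF U(2), of "(0, x /\<^sub>R norm x)"], of "(1, 0)"]
      by (simp add: dr_def dx_def)
  qed
  also have "\<dots> = frechet_derivative (\<lambda>q. frechet_derivative u (at q) (1, 0)) (at (t, x)) (0, x /\<^sub>R norm x)"
    by (rule mixed_partials_eq[OF U(1,2) u])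
  finally show ?thesis by (simp add: dr_def dx_def dt_def[abs_def])
qed

text \<open>The speed depends on u: its derivative along v is -3 G c^3 \<partial>t u times that of
  \<partial>t u, and the two terms with factor 3 G come from v = (1, 0) and from the radial v. The
  factor 2 in front of c collects the two mixed derivatives.\<close>

lemma Lbar_Lbar:
  fixes u :: "real \<times> (real^3) \<Rightarrow> real"
  assumes U: "open U" "(t, x) \<in> U" "Ck_on 2 U u" and x: "x \<noteq> 0"
    and pos: "0 < 1 + 3 * G * (dt u (t, x))\<^sup>2"
  defines "p \<equiv> (t, x)"
  defines "c \<equiv> speed G u p"
  shows "Lbar G u (Lbar G u u) p = dt (dt u) p + 3 * G * c ^ 3 * dt u p * dt (dt u) p * dr u p
    - 2 * c * dr (dt u) p - 3 * G * c ^ 4 * dt u p * dr (dt u) p * dr u p + c\<^sup>2 * dr (dr u) p"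
proof -
  note u = Ck_on_2_open[OF U(1,3)]
  let ?F = "\<lambda>f. frechet_derivative f (at p)"
  have "dr u differentiable at p"
    unfolding p_def by (rule dr_differentiable[OF U(1,2) _ u(1,2)]) (use x U in auto)
  then have dr: "(dr u has_derivative ?F (dr u)) (at p)"
    by (simp add: frechet_derivative_works[symmetric])
  have "dt u differentiable at p"
    unfolding dt_def[abs_def] p_def by (rule u(2)[OF U(2)])
  then have dt: "(dt u has_derivative ?F (dt u)) (at p)"
    by (simp add: frechet_derivative_works[symmetric])
  have pos: "0 < 1 + 3 * G * (dt u p)\<^sup>2" using pos by (simp add: p_def)
  \<comment> \<open>The exponent -3/2 = -1/2 - 1 arises when the speed is differentiated.\<close>
  have c3: "(1 + 3 * G * (dt u p)\<^sup>2) powr (-3/2) = c ^ 3"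
  proof -
    have "c ^ 3 = ((1 + 3 * G * (dt u p)\<^sup>2) powr (-1/2)) powr 3"
      using pos by (simp add: c_def speed_def powr_realpow[of _ 3, simplified])
    then show ?thesis by (simp add: powr_powr)
  qed
  have sp: "(speed G u has_derivative (\<lambda>v. - 3 * G * c ^ 3 * dt u p * ?F (dt u) v)) (at p)"
  proof -
    have "((\<lambda>y. y powr (-1/2)) has_real_derivative
        (-1/2) * (1 + 3 * G * (dt u p)\<^sup>2) powr (-1/2 - 1)) (at (1 + 3 * G * (dt u p)\<^sup>2))"
      using has_real_derivative_powr[OF pos, of "-1/2"] by simp
    then have "((\<lambda>y. y powr (-1/2)) has_real_derivative (-1/2) * c ^ 3) (at (1 + 3 * G * (dt u p)\<^sup>2))"
      using c3 by simp
    then have "((\<lambda>y. y powr (-1/2)) has_derivative (*) ((-1/2) * c ^ 3)) (at (1 + 3 * G * (dt u p)\<^sup>2))"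
      by (rule has_field_derivative_imp_has_derivative)
    moreover have "((\<lambda>q. 1 + 3 * G * (dt u q)\<^sup>2) has_derivative (\<lambda>v. 3 * G * (2 * dt u p * ?F (dt u) v))) (at p)"
      by (auto intro!: derivative_eq_intros dt)
    ultimately have "((\<lambda>q. (1 + 3 * G * (dt u q)\<^sup>2) powr (-1/2)) has_derivative
        (\<lambda>v. ((-1/2) * c ^ 3) * (3 * G * (2 * dt u p * ?F (dt u) v)))) (at p)"
      by (rule has_derivative_compose[rotated])
    then show ?thesis unfolding speed_def by (simp add: algebra_simps)
  qed
  have L: "(Lbar G u u has_derivative (\<lambda>v. ?F (dt u) v - (c * ?F (dr u) v
      + (- 3 * G * c ^ 3 * dt u p * ?F (dt u) v) * dr u p))) (at p)"
    unfolding Lbar_def[abs_def] c_def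
    by (intro has_derivative_diff has_derivative_mult dt dr sp[unfolded c_def])
  note LD = frechet_derivative_eqI_at[OF L]
  have mixed: "?F (dr u) (1, 0) = dr (dt u) p"
    using dt_dr_commute[OF U x] by (simp add: p_def dt_def[of "dr u"])
  have "Lbar G u (Lbar G u u) p = ?F (Lbar G u u) (1, 0) - c * ?F (Lbar G u u) (0, x /\<^sub>R norm x)"
    by (simp add: Lbar_def[of G u "Lbar G u u"] c_def dt_def[of "Lbar G u u"] dr_def dx_def p_def)
  moreover have "?F (dt u) (1, 0) = dt (dt u) p" "?F (dt u) (0, x /\<^sub>R norm x) = dr (dt u) p"
    "?F (dr u) (0, x /\<^sub>R norm x) = dr (dr u) p"
    by (simp_all add: dt_def[of "dt u"] dr_def[of "dt u"] dr_def[of "dr u"] dx_def p_def)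
  ultimately show ?thesis
    unfolding LD mixed by (simp add: algebra_simps power2_eq_square eval_nat_numeral)
qed

section \<open>Homogeneous functions and polar coordinates on the slice\<close>

definition homogeneous :: "(real \<times> 'b::real_normed_vector \<Rightarrow> real) \<Rightarrow> bool" where
  "homogeneous H \<longleftrightarrow> (\<forall>s y c. 0 < c \<longrightarrow> H (s, c *\<^sub>R y) = H (s, y))"

lemma axis_accessible_cyl_ext: "axis_accessible cyl_ext"
  unfolding cyl_ext_def by (rule axis_accessible_strip) auto

lemma at_within_cyl_ext:
  assumes "0 < s" "s < 1" "y \<noteq> 0"
  shows "at (s, y) within cyl_ext = at (s, y)"
  by (rule at_within_nhd[of _ "{0<..<1} \<times> - {0}"]) (use assms in \<open>auto simp: cyl_ext_def intro!: open_Times\<close>)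

abbreviation cyl_deriv :: "real \<times> (real^3) \<Rightarrow> (real \<times> (real^3) \<Rightarrow> real) \<Rightarrow> real \<times> (real^3) \<Rightarrow> real" where
  "cyl_deriv v H p \<equiv> frechet_derivative H (at p within cyl_ext) v"

lemma cyl_deriv_linear:
  "H differentiable_on cyl_ext \<Longrightarrow> p \<in> cyl_ext \<Longrightarrow> linear (\<lambda>v. cyl_deriv v H p)"
  by (metis frechet_derivative_within_has_derivative has_derivative_linear)

lemma has_real_derivative_norm_line:
  assumes "x \<noteq> 0"
  shows "((\<lambda>t. norm (x + t *\<^sub>R e)) has_real_derivative x \<bullet> e / norm x) (at 0)"
proof -
  have "(norm has_derivative (\<lambda>h. h \<bullet> sgn x)) (at (x + 0 *\<^sub>R e))"
    using has_derivative_norm[of x] assms by simp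
  moreover have "((\<lambda>t. x + t *\<^sub>R e) has_derivative (\<lambda>t. t *\<^sub>R e)) (at 0)"
    by (auto intro!: derivative_eq_intros)
  ultimately have "((\<lambda>t. norm (x + t *\<^sub>R e)) has_derivative (\<lambda>t. (t *\<^sub>R e) \<bullet> sgn x)) (at 0)"
    by (rule has_derivative_compose[rotated])
  then show ?thesis
    by (rule has_derivative_imp_has_field_derivative)
      (simp add: sgn_div_norm inner_commute divide_inverse)
qed

context
  fixes r \<delta> :: real and x :: "real^3"
  assumes r: "0 < r" and \<delta>: "0 < \<delta>" and x: "r < norm x" "norm x < r + \<delta>"
begin

lemma slice_bounds: "x \<noteq> 0" "0 < (norm x - r) / \<delta>" "(norm x - r) / \<delta> < 1"
  using r \<delta> x by auto

text \<open>R is a constant, not |x + t e|: the second argument is then affine in t, and by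
  homogeneity nothing is lost by not normalising it along the line.\<close>

lemma has_real_derivative_slice:
  assumes H: "H differentiable_on cyl_ext" and R: "0 < R"
  defines "p \<equiv> ((norm x - r) / \<delta>, x /\<^sub>R R)"
  shows "((\<lambda>t. H ((norm (x + t *\<^sub>R e) - r) / \<delta>, (x + t *\<^sub>R e) /\<^sub>R R)) has_real_derivative
    x \<bullet> e / norm x / \<delta> * cyl_deriv (1, 0) H p + cyl_deriv (0, e) H p / R) (at 0)"
proof -
  let ?g = "\<lambda>t. ((norm (x + t *\<^sub>R e) - r) / \<delta>, (x + t *\<^sub>R e) /\<^sub>R R)"
  have p: "p \<in> cyl_ext" using slice_bounds R by (simp add: p_def cyl_ext_def)
  have within: "at p within cyl_ext = at (?g 0)"
    unfolding p_def using slice_bounds R by (subst at_within_cyl_ext) auto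
  have H': "(H has_derivative frechet_derivative H (at p within cyl_ext)) (at (?g 0))"
    using frechet_derivative_within_has_derivative[OF H p] within by simp
  have "((\<lambda>t. norm (x + t *\<^sub>R e)) has_derivative (\<lambda>t. t * (x \<bullet> e / norm x))) (at 0)"
    using has_real_derivative_norm_line[OF slice_bounds(1), of e]
    unfolding has_field_derivative_def by (rule has_derivative_eq_rhs) (simp add: fun_eq_iff)
  then have "(?g has_derivative (\<lambda>t. ((t * (x \<bullet> e / norm x)) / \<delta>, (t *\<^sub>R e) /\<^sub>R R))) (at 0)"
    by (auto intro!: derivative_eq_intros simp: divide_inverse)
  from has_derivative_compose[OF this H']
  have "((\<lambda>t. H (?g t)) has_derivative (\<lambda>t. cyl_deriv ((t * (x \<bullet> e / norm x)) / \<delta>, (t *\<^sub>R e) /\<^sub>R R) H p)) (at 0)" .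
  then show ?thesis
  proof (rule has_derivative_imp_has_field_derivative)
    fix t
    note lin = cyl_deriv_linear[OF H p]
    have "((t * (x \<bullet> e / norm x)) / \<delta>, (t *\<^sub>R e) /\<^sub>R R)
        = (t * (x \<bullet> e / norm x / \<delta>)) *\<^sub>R (1, 0) + (t / R) *\<^sub>R (0, e)"
      by (simp add: divide_inverse mult.commute)
    then show "t * (x \<bullet> e / norm x / \<delta> * cyl_deriv (1, 0) H p + cyl_deriv (0, e) H p / R)
        = cyl_deriv ((t * (x \<bullet> e / norm x)) / \<delta>, (t *\<^sub>R e) /\<^sub>R R) H p"
      unfolding \<open>_ = _ + _\<close> linear_add[OF lin] linear_scale[OF lin] by (simp add: algebra_simps)
  qed
qed

end

text \<open>Euler's identity in degree 0: the function is constant along the ray (1 + t) y for t >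
  -1.\<close>

lemma cyl_deriv_radial:
  assumes H: "H differentiable_on cyl_ext" "homogeneous H" and s: "0 < s" "s < 1" "y \<noteq> 0"
  shows "cyl_deriv (0, y) H (s, y) = 0"
proof -
  have "H differentiable at (s, y) within cyl_ext"
    using s by (intro differentiable_onD[OF H(1)]) (auto simp: cyl_ext_def)
  then have "H differentiable at (s, y)" by (simp only: at_within_cyl_ext[OF s])
  from frechet_derivative_line[OF this, of "(0, y)"]
  have "((\<lambda>t. H (s, (1 + t) *\<^sub>R y)) has_real_derivative cyl_deriv (0, y) H (s, y)) (at 0)"
    using at_within_cyl_ext[OF s] by (simp add: scaleR_add_left)
  moreover have "((\<lambda>t. H (s, (1 + t) *\<^sub>R y)) has_real_derivative 0) (at 0)"
  proof (rule has_field_derivative_transform_within_open[where S = "{-1<..}"])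
    show "((\<lambda>t. H (s, y)) has_real_derivative 0) (at 0)" by simp
  qed (use H(2) in \<open>auto simp: homogeneous_def\<close>)
  ultimately show ?thesis by (rule DERIV_unique)
qed

lemma sum_inner_Basis_power2: "(\<Sum>e\<in>Basis. (v \<bullet> e)\<^sup>2) = (norm v)\<^sup>2" for v :: "'b::euclidean_space"
  unfolding power2_norm_eq_inner euclidean_inner[of v v] by (simp add: power2_eq_square)

text \<open>The Laplacian in polar coordinates. The sum over \<open>Basis\<close>, at a unit vector
  and for a function homogeneous of degree 0, is the spherical Laplacian. W names the s-derivative
  of F0 because for the profile it is an explicit expression that is differentiated once
  more.\<close>

lemma short_pulse_slice:
  fixes u F0 F1 W :: "real \<times> (real^3) \<Rightarrow> real" and x :: "real^3"
  assumes U: "open U" "{-r} \<times> ball 0 (r + \<delta>) \<subseteq> U" "Ck_on 2 U u"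
    and r: "0 < r" "0 < \<delta>"
    and data: "\<And>y. r < norm y \<Longrightarrow> norm y < r + \<delta> \<Longrightarrow>
      u (-r, y) = A * F0 ((norm y - r) / \<delta>, y) \<and> dt u (-r, y) = B * F1 ((norm y - r) / \<delta>, y)"
    and F0: "homogeneous F0" "Ck_on 2 cyl_ext F0"
    and F1: "homogeneous F1" "F1 differentiable_on cyl_ext"
    and W: "homogeneous W" "W differentiable_on cyl_ext" "\<And>p. p \<in> cyl_ext \<Longrightarrow> cyl_deriv (1, 0) F0 p = W p"
    and x: "r < norm x" "norm x < r + \<delta>"
  defines "p \<equiv> (-r, x)" and "E \<equiv> ((norm x - r) / \<delta>, x /\<^sub>R norm x)"
  shows "dt u p = B * F1 E"
    and "dr u p = A / \<delta> * W E"
    and "dr (dt u) p = B / \<delta> * cyl_deriv (1, 0) F1 E"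
    and "dr (dr u) p = A / \<delta>\<^sup>2 * cyl_deriv (1, 0) W E"
    and "laplacian u p = A * (cyl_deriv (1, 0) W E / \<delta>\<^sup>2 + 2 * W E / (norm x * \<delta>)
      + (\<Sum>e\<in>Basis. cyl_deriv (0, e) (cyl_deriv (0, e) F0) E) / (norm x)\<^sup>2)"
proof -
  note u = Ck_on_2_open[OF U(1,3)]
  let ?\<Omega> = "{y :: real^3. r < norm y \<and> norm y < r + \<delta>}"
  have \<Omega>: "open ?\<Omega>" by (intro open_Collect_conj open_Collect_less continuous_intros)
  have inU: "(-r, y) \<in> U" if "y \<in> ?\<Omega>" for y using that U(2) by auto
  have hom: "H (s, y /\<^sub>R R) = H (s, y)" if "homogeneous H" "0 < R" for H s R and y :: "real^3"
    using that by (simp add: homogeneous_def)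
  have F0d: "F0 differentiable_on cyl_ext" "cyl_deriv v F0 differentiable_on cyl_ext" for v
    using F0(2) unfolding numeral_2_eq_2
    by (intro Ck_on_Suc_differentiable Ck_on_Suc_deriv, assumption)+
  \<comment> \<open>R stays fixed when derivatives in x are taken: by homogeneity \<open>F0 (s, y) = F0 (s, y / R)\<close>, and at
    \<open>y = x\<close> the derivatives of F0 are then evaluated on the cylinder, where they are bounded.\<close>
  define R where "R = norm x"
  define n where "n = x /\<^sub>R R"
  define s where "s = (norm x - r) / \<delta>"
  have R: "0 < R" using x r unfolding R_def by linarith
  have n: "norm n = 1" "n \<bullet> n = 1" "n \<noteq> 0" using R by (auto simp: n_def R_def dot_square_norm)
  have s: "0 < s" "s < 1" using x r by (auto simp: s_def)
  have En: "E = (s, n)" by (simp add: E_def s_def n_def R_def)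
  have Ec: "E \<in> cyl_ext" using s n by (simp add: En cyl_ext_def)
  have xn: "x = R *\<^sub>R n" using R by (simp add: n_def)

  \<comment> \<open>Here \<open>R\<close> is universally quantified again: \<open>radial\<close>
    takes it to be \<open>norm y\<close>, whereas the Laplacian keeps the value fixed above.\<close>
  have slice: "dx e f (-r, y) = K * (y \<bullet> e / norm y / \<delta> * cyl_deriv (1, 0) H ((norm y - r) / \<delta>, y /\<^sub>R R)
      + cyl_deriv (0, e) H ((norm y - r) / \<delta>, y /\<^sub>R R) / R)"
    if f: "f differentiable at (-r, y)" and y: "y \<in> ?\<Omega>" and H: "homogeneous H" "H differentiable_on cyl_ext"
      and eq: "\<And>y. y \<in> ?\<Omega> \<Longrightarrow> f (-r, y) = K * H ((norm y - r) / \<delta>, y)" and R: "0 < R"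
    for f e y K H R
  proof (rule dx_eqI[OF f])
    have "((\<lambda>t. K * H ((norm (y + t *\<^sub>R e) - r) / \<delta>, (y + t *\<^sub>R e) /\<^sub>R R)) has_real_derivative
      K * (y \<bullet> e / norm y / \<delta> * cyl_deriv (1, 0) H ((norm y - r) / \<delta>, y /\<^sub>R R)
      + cyl_deriv (0, e) H ((norm y - r) / \<delta>, y /\<^sub>R R) / R)) (at 0)"
      using y by (intro DERIV_cmult has_real_derivative_slice r R H) auto
    then show "((\<lambda>t. f (-r, y + t *\<^sub>R e)) has_real_derivative
      K * (y \<bullet> e / norm y / \<delta> * cyl_deriv (1, 0) H ((norm y - r) / \<delta>, y /\<^sub>R R)
      + cyl_deriv (0, e) H ((norm y - r) / \<delta>, y /\<^sub>R R) / R)) (at 0)"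
    proof (rule has_field_derivative_transform_within_open)
      show "open ((\<lambda>t. y + t *\<^sub>R e) -` ?\<Omega>)"
        by (intro open_vimage \<Omega> continuous_intros)
    qed (use y R H eq in \<open>auto simp: hom\<close>)
  qed
  have radial: "dr f (-r, y) = K / \<delta> * cyl_deriv (1, 0) H ((norm y - r) / \<delta>, y /\<^sub>R norm y)"
    if f: "f differentiable at (-r, y)" and y: "y \<in> ?\<Omega>" and H: "homogeneous H" "H differentiable_on cyl_ext"
      and eq: "\<And>y. y \<in> ?\<Omega> \<Longrightarrow> f (-r, y) = K * H ((norm y - r) / \<delta>, y)"
    for f y K H
  proof -
    have y0: "0 < norm y" using y r by auto
    have "cyl_deriv (0, y /\<^sub>R norm y) H ((norm y - r) / \<delta>, y /\<^sub>R norm y) = 0"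
      using y r by (intro cyl_deriv_radial H) auto
    moreover have "y \<bullet> (y /\<^sub>R norm y) / norm y = 1"
      using y0 by (simp add: dot_square_norm power2_eq_square)
    ultimately show ?thesis
      using slice[OF that y0, of "y /\<^sub>R norm y"] unfolding dr_def by simp
  qed

  show "dt u p = B * F1 E" using data[OF x] F1(1) R by (simp add: p_def E_def hom R_def)
  have ud: "u differentiable at (-r, y)" if "y \<in> ?\<Omega>" for y using u(1)[OF inU[OF that]] .
  have dru: "dr u (-r, y) = A / \<delta> * W ((norm y - r) / \<delta>, y)" if y: "y \<in> ?\<Omega>" for y
  proof -
    have "dr u (-r, y) = A / \<delta> * cyl_deriv (1, 0) F0 ((norm y - r) / \<delta>, y /\<^sub>R norm y)"
      using data by (intro radial[OF ud[OF y] y F0(1) F0d(1)]) auto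
    also have "cyl_deriv (1, 0) F0 ((norm y - r) / \<delta>, y /\<^sub>R norm y) = W ((norm y - r) / \<delta>, y /\<^sub>R norm y)"
      using y r by (intro W(3)) (auto simp: cyl_ext_def)
    also have "\<dots> = W ((norm y - r) / \<delta>, y)" using y r by (intro hom W) auto
    finally show ?thesis .
  qed
  show "dr u p = A / \<delta> * W E" using dru[of x] x hom[OF W(1) R, of _ x] by (simp add: p_def E_def R_def)
  have "dt u differentiable at (-r, x)"
    unfolding dt_def[abs_def] using u(2)[OF inU] x by auto
  then show "dr (dt u) p = B / \<delta> * cyl_deriv (1, 0) F1 E"
    unfolding p_def E_def using x data by (intro radial F1) auto
  have "dr u differentiable at (-r, x)"
    using x r inU by (intro dr_differentiable[OF U(1) _ _ u(1,2)]) auto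
  then have "dr (dr u) p = A / \<delta> / \<delta> * cyl_deriv (1, 0) W E"
    unfolding p_def E_def using x dru by (intro radial W) auto
  then show "dr (dr u) p = A / \<delta>\<^sup>2 * cyl_deriv (1, 0) W E" by (simp add: power2_eq_square)

  let ?D = "\<lambda>e. cyl_deriv (0, e) F0"
  have dxu: "dx e u (-r, y) = A * (y \<bullet> e / norm y / \<delta> * W ((norm y - r) / \<delta>, y /\<^sub>R R)
      + ?D e ((norm y - r) / \<delta>, y /\<^sub>R R) / R)" if y: "y \<in> ?\<Omega>" for e y
  proof -
    have "((norm y - r) / \<delta>, y /\<^sub>R R) \<in> cyl_ext" using y r R by (auto simp: cyl_ext_def)
    from W(3)[OF this] show ?thesis
      using slice[OF ud[OF y] y F0(1) F0d(1) _ R, of A e] data by auto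
  qed
  have dxx: "dx e (dx e u) p = A * ((1 - (n \<bullet> e)\<^sup>2) / R / \<delta> * W E
      + n \<bullet> e / \<delta> * (n \<bullet> e / \<delta> * cyl_deriv (1, 0) W E + cyl_deriv (0, e) W E / R)
      + (n \<bullet> e / \<delta> * cyl_deriv (1, 0) (?D e) E + cyl_deriv (0, e) (?D e) E / R) / R)"
    if e: "e \<in> Basis" for e
    unfolding p_def
  proof (rule dx_eqI)
    show "dx e u differentiable at (-r, x)"
      unfolding dx_def[abs_def] using u(2)[OF inU] x by auto
    have ne: "x \<bullet> e / norm x = n \<bullet> e" by (simp add: n_def R_def divide_inverse mult.commute)
    have "((\<lambda>t. norm (x + t *\<^sub>R e)) has_real_derivative n \<bullet> e) (at 0)"
      using has_real_derivative_norm_line[of x e] R ne by (auto simp: R_def)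
    moreover have "((\<lambda>t. (x + t *\<^sub>R e) \<bullet> e) has_real_derivative 1) (at 0)"
      using e by (auto intro!: derivative_eq_intros simp: inner_add_left)
    ultimately have "((\<lambda>t. (x + t *\<^sub>R e) \<bullet> e / norm (x + t *\<^sub>R e)) has_real_derivative
        (1 * norm (x + 0 *\<^sub>R e) - (x + 0 *\<^sub>R e) \<bullet> e * (n \<bullet> e)) / (norm (x + 0 *\<^sub>R e) * norm (x + 0 *\<^sub>R e))) (at 0)"
      using R by (intro DERIV_divide) (auto simp: R_def)
    moreover have "(1 * norm (x + 0 *\<^sub>R e) - (x + 0 *\<^sub>R e) \<bullet> e * (n \<bullet> e)) / (norm (x + 0 *\<^sub>R e) * norm (x + 0 *\<^sub>R e))
        = (1 - (n \<bullet> e)\<^sup>2) / R"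
      using R ne by (simp add: R_def field_simps power2_eq_square)
    ultimately have q: "((\<lambda>t. (x + t *\<^sub>R e) \<bullet> e / norm (x + t *\<^sub>R e)) has_real_derivative (1 - (n \<bullet> e)\<^sup>2) / R) (at 0)"
      by simp
    have sl: "((\<lambda>t. H ((norm (x + t *\<^sub>R e) - r) / \<delta>, (x + t *\<^sub>R e) /\<^sub>R R)) has_real_derivative
        n \<bullet> e / \<delta> * cyl_deriv (1, 0) H E + cyl_deriv (0, e) H E / R) (at 0)"
      if "H differentiable_on cyl_ext" for H
      using has_real_derivative_slice[OF r x that R, of e] unfolding ne by (simp add: E_def R_def)
    have "((\<lambda>t. A * ((x + t *\<^sub>R e) \<bullet> e / norm (x + t *\<^sub>R e) / \<delta> * W ((norm (x + t *\<^sub>R e) - r) / \<delta>, (x + t *\<^sub>R e) /\<^sub>R R)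
        + ?D e ((norm (x + t *\<^sub>R e) - r) / \<delta>, (x + t *\<^sub>R e) /\<^sub>R R) / R)) has_real_derivative
      A * ((1 - (n \<bullet> e)\<^sup>2) / R / \<delta> * W ((norm (x + 0 *\<^sub>R e) - r) / \<delta>, (x + 0 *\<^sub>R e) /\<^sub>R R)
        + (n \<bullet> e / \<delta> * cyl_deriv (1, 0) W E + cyl_deriv (0, e) W E / R)
          * ((x + 0 *\<^sub>R e) \<bullet> e / norm (x + 0 *\<^sub>R e) / \<delta>)
      + (n \<bullet> e / \<delta> * cyl_deriv (1, 0) (?D e) E + cyl_deriv (0, e) (?D e) E / R) / R)) (at 0)"
      by (intro DERIV_cmult DERIV_add DERIV_mult DERIV_cdivide q sl W F0d)
    then have der: "((\<lambda>t. A * ((x + t *\<^sub>R e) \<bullet> e / norm (x + t *\<^sub>R e) / \<delta> * W ((norm (x + t *\<^sub>R e) - r) / \<delta>, (x + t *\<^sub>R e) /\<^sub>R R)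
        + ?D e ((norm (x + t *\<^sub>R e) - r) / \<delta>, (x + t *\<^sub>R e) /\<^sub>R R) / R)) has_real_derivative
      A * ((1 - (n \<bullet> e)\<^sup>2) / R / \<delta> * W E
      + n \<bullet> e / \<delta> * (n \<bullet> e / \<delta> * cyl_deriv (1, 0) W E + cyl_deriv (0, e) W E / R)
      + (n \<bullet> e / \<delta> * cyl_deriv (1, 0) (?D e) E + cyl_deriv (0, e) (?D e) E / R) / R)) (at 0)"
      using ne by (simp add: E_def R_def mult.commute)
    show "((\<lambda>t. dx e u (-r, x + t *\<^sub>R e)) has_real_derivative
      A * ((1 - (n \<bullet> e)\<^sup>2) / R / \<delta> * W E
      + n \<bullet> e / \<delta> * (n \<bullet> e / \<delta> * cyl_deriv (1, 0) W E + cyl_deriv (0, e) W E / R)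
      + (n \<bullet> e / \<delta> * cyl_deriv (1, 0) (?D e) E + cyl_deriv (0, e) (?D e) E / R) / R)) (at 0)"
    proof (rule has_field_derivative_transform_within_open[OF der])
      show "open ((\<lambda>t. x + t *\<^sub>R e) -` ?\<Omega>)"
        by (intro open_vimage \<Omega> continuous_intros)
    qed (use x in \<open>auto simp: dxu\<close>)
  qed
  have n_sum: "n = (\<Sum>e\<in>Basis. (n \<bullet> e) *\<^sub>R e)" by (simp add: euclidean_representation)
  have n_pair: "(0 :: real, n) = (\<Sum>e\<in>Basis. (n \<bullet> e) *\<^sub>R (0, e))"
    by (subst n_sum) (simp add: prod_eq_iff fst_sum snd_sum)
  have along_n: "(\<Sum>e\<in>Basis. (n \<bullet> e) * cyl_deriv (0, e) H q) = cyl_deriv (0, n) H q"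
    if "H differentiable_on cyl_ext" "q \<in> cyl_ext" for H q
    unfolding n_pair linear_sum[OF cyl_deriv_linear[OF that]] linear_scale[OF cyl_deriv_linear[OF that]]
    by simp
  have W0: "(\<Sum>e\<in>Basis. (n \<bullet> e) * cyl_deriv (0, e) W E) = 0"
    unfolding along_n[OF W(2) Ec] unfolding En by (rule cyl_deriv_radial[OF W(2,1) s n(3)])
  \<comment> \<open>Euler's identity holds at (s + t, n) for all small t with n fixed;
    differentiating it in t gives the claim without exchanging derivatives of F0.\<close>
  have D0: "(\<Sum>e\<in>Basis. (n \<bullet> e) * cyl_deriv (1, 0) (?D e) E) = 0"
  proof -
    have "((\<lambda>t. \<Sum>e\<in>Basis. (n \<bullet> e) * ?D e (s + t, n)) has_real_derivative
        (\<Sum>e\<in>Basis. (n \<bullet> e) * cyl_deriv (1, 0) (?D e) E)) (at 0)"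
    proof (intro DERIV_sum DERIV_cmult)
      fix e
      have "?D e differentiable at E within cyl_ext"
        by (rule differentiable_onD[OF F0d(2) Ec])
      then have "?D e differentiable at E"
        unfolding En by (simp only: at_within_cyl_ext[OF s n(3)])
      from frechet_derivative_line[OF this, of "(1, 0)"]
      show "((\<lambda>t. ?D e (s + t, n)) has_real_derivative cyl_deriv (1, 0) (?D e) E) (at 0)"
        unfolding En at_within_cyl_ext[OF s n(3)] by simp
    qed
    moreover have "((\<lambda>t. \<Sum>e\<in>Basis. (n \<bullet> e) * ?D e (s + t, n)) has_real_derivative 0) (at 0)"
    proof (rule has_field_derivative_transform_within_open[where S = "{-s<..<1-s}"])
      show "((\<lambda>t. 0) has_real_derivative 0) (at 0)" by simp
      fix t assume t: "t \<in> {-s<..<1-s}"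
      then have "(s + t, n) \<in> cyl_ext" using n by (auto simp: cyl_ext_def)
      from along_n[OF F0d(1) this]
      have "(\<Sum>e\<in>Basis. (n \<bullet> e) * ?D e (s + t, n)) = cyl_deriv (0, n) F0 (s + t, n)" .
      also have "\<dots> = 0" using t n by (intro cyl_deriv_radial F0 F0d) auto
      finally show "0 = (\<Sum>e\<in>Basis. (n \<bullet> e) * ?D e (s + t, n))" by simp
    qed (use s in auto)
    ultimately show ?thesis by (rule DERIV_unique)
  qed
  have n1: "(\<Sum>e\<in>Basis. (n \<bullet> e)\<^sup>2) = 1" using n(1) by (simp add: sum_inner_Basis_power2)
  have "laplacian u p = (\<Sum>e\<in>Basis. A * ((1 - (n \<bullet> e)\<^sup>2) / R / \<delta> * W E
      + n \<bullet> e / \<delta> * (n \<bullet> e / \<delta> * cyl_deriv (1, 0) W E + cyl_deriv (0, e) W E / R)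
      + (n \<bullet> e / \<delta> * cyl_deriv (1, 0) (?D e) E + cyl_deriv (0, e) (?D e) E / R) / R))"
    unfolding laplacian_def by (intro sum.cong refl dxx)
  also have "\<dots> = (\<Sum>e\<in>Basis. A * (W E / (R * \<delta>)) * (1 - (n \<bullet> e)\<^sup>2)
      + A * cyl_deriv (1, 0) W E / \<delta>\<^sup>2 * (n \<bullet> e)\<^sup>2
      + A / (R * \<delta>) * ((n \<bullet> e) * cyl_deriv (0, e) W E)
      + A / (R * \<delta>) * ((n \<bullet> e) * cyl_deriv (1, 0) (?D e) E)
      + A / R\<^sup>2 * cyl_deriv (0, e) (?D e) E)"
    by (intro sum.cong refl) (simp add: algebra_simps power2_eq_square add_divide_distrib diff_divide_distrib)
  also have "\<dots> = A * (W E / (R * \<delta>)) * (\<Sum>e\<in>Basis. 1 - (n \<bullet> e)\<^sup>2)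
      + A * cyl_deriv (1, 0) W E / \<delta>\<^sup>2 * (\<Sum>e\<in>Basis. (n \<bullet> e)\<^sup>2)
      + A / (R * \<delta>) * (\<Sum>e\<in>Basis. (n \<bullet> e) * cyl_deriv (0, e) W E)
      + A / (R * \<delta>) * (\<Sum>e\<in>Basis. (n \<bullet> e) * cyl_deriv (1, 0) (?D e) E)
      + A / R\<^sup>2 * (\<Sum>e\<in>Basis. cyl_deriv (0, e) (?D e) E)"
    by (simp only: sum.distrib sum_distrib_left)
  \<comment> \<open>Dimension 3 minus 1: the origin of the coefficient in (2 / r)
    \<partial>r.\<close>
  also have "(\<Sum>e\<in>Basis. 1 - (n \<bullet> e)\<^sup>2) = 2"
    unfolding sum_subtractf n1 by simp
  finally show "laplacian u p = A * (cyl_deriv (1, 0) W E / \<delta>\<^sup>2 + 2 * W E / (norm x * \<delta>)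
      + (\<Sum>e\<in>Basis. cyl_deriv (0, e) (?D e) E) / (norm x)\<^sup>2)"
    unfolding n1 W0 D0 by (simp add: R_def algebra_simps)
qed

section \<open>The profile and its estimates\<close>

lemma cyl_subset_cyl_ext: "cyl \<subseteq> cyl_ext"
  by (auto simp: cyl_def cyl_ext_def)

lemma Ck_norm_le_iff: "Ck_norm k \<phi> \<le> ereal M \<longleftrightarrow> deriv_bound cyl_ext cyl k (hom_ext \<phi>) M"
  by (auto simp: Ck_norm_def deriv_bound_def SUP_le_iff)

lemma Ck_norm_nonneg: "0 \<le> Ck_norm k \<phi>"
proof -
  have "(1, axis 1 1) \<in> cyl" by (simp add: cyl_def)
  then have "0 \<le> (SUP p\<in>cyl. ereal \<bar>iter_deriv cyl_ext [] (hom_ext \<phi>) p\<bar>)"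
    by (rule SUP_upper2) simp
  also have "\<dots> \<le> Ck_norm k \<phi>"
    unfolding Ck_norm_def by (rule SUP_upper) simp
  finally show ?thesis .
qed

definition vanishes_below :: "real \<Rightarrow> (real \<times> (real^3) \<Rightarrow> real) \<Rightarrow> bool" where
  "vanishes_below b H \<longleftrightarrow> (\<forall>s y. 0 < s \<longrightarrow> s < b \<longrightarrow> s \<le> 1 \<longrightarrow> y \<in> - {0} \<longrightarrow> H (s, y) = 0)"

text \<open>(0,1] is not compact, but F and its derivatives vanish for s < b, and on the compact
  remainder of the cylinder continuity gives a bound. This makes the norms of the seed data
  finite.\<close>

lemma deriv_bound_exists:
  assumes "0 < b"
  shows "Ck_on k cyl_ext F \<Longrightarrow> vanishes_below b F \<Longrightarrow> \<exists>M. deriv_bound cyl_ext cyl k F M"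
proof (induction k arbitrary: F)
  case (0 F)
  let ?K = "{b..1} \<times> sphere (0 :: real^3) 1"
  have "compact (F ` ?K)"
    by (rule compact_continuous_image[OF continuous_on_subset[of cyl_ext]])
      (use 0 assms in \<open>auto simp: cyl_ext_def intro!: compact_Times\<close>)
  from compact_imp_bounded[OF this] obtain M where M: "\<And>x. x \<in> F ` ?K \<Longrightarrow> \<bar>x\<bar> \<le> M"
    unfolding bounded_iff real_norm_def by blast
  have "\<bar>F p\<bar> \<le> \<bar>M\<bar>" if "p \<in> cyl" for p
  proof (cases "fst p < b")
    case True
    have "snd p \<noteq> 0" using that by (auto simp: cyl_def)
    with True have "F (fst p, snd p) = 0"
      using that 0(2)[unfolded vanishes_below_def, rule_format, of "fst p" "snd p"]
      by (auto simp: cyl_def)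
    then show ?thesis by simp
  next
    case False
    then show ?thesis using that M[of "F p"] by (force simp: cyl_def)
  qed
  then show ?case unfolding deriv_bound_0 by blast
next
  case (Suc k F)
  have V: "open (- {0 :: real^3})" by auto
  have "\<exists>M. deriv_bound cyl_ext cyl k (cyl_deriv v F) M" for v
  proof (rule Suc.IH)
    show "Ck_on k cyl_ext (cyl_deriv v F)" using Suc.prems(1) by (rule Ck_on_Suc_deriv)
    show "vanishes_below b (cyl_deriv v F)"
      unfolding vanishes_below_def cyl_ext_def
      using vanishing_frechet_derivative[OF V, of b F] Suc.prems(2)
      by (simp add: vanishes_below_def)
  qed
  then obtain M where M: "\<And>v. deriv_bound cyl_ext cyl k (cyl_deriv v F) (M v)" by metis
  obtain M0 where M0: "deriv_bound cyl_ext cyl k F M0"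
    using Suc.IH[OF Ck_on_SucD[OF Suc.prems(1)] Suc.prems(2)] by blast
  let ?N = "\<bar>M0\<bar> + (\<Sum>v\<in>Basis. \<bar>M v\<bar>)"
  have "deriv_bound cyl_ext cyl k (cyl_deriv v F) ?N" if "v \<in> Basis" for v
    using M[of v]
  proof (rule deriv_bound_mono)
    show "M v \<le> ?N" using member_le_sum[of v Basis "\<lambda>v. \<bar>M v\<bar>"] that by fastforce
  qed
  moreover have "\<bar>F p\<bar> \<le> ?N" if "p \<in> cyl" for p
  proof -
    have "0 \<le> (\<Sum>v\<in>Basis. \<bar>M v\<bar>)" by (intro sum_nonneg) simp
    with deriv_bound_D0[OF M0 that] show ?thesis by linarith
  qed
  ultimately show ?case unfolding deriv_bound_Suc by blast
qed

text \<open>g stands for (G''(0) / 2) \<kappa> and e for \<epsilon>. They are kept as free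
  parameters so that regularity and bounds hold for all of them at once; the form as a sum of
  multiples matches the closure lemmas.\<close>

definition profile :: "real \<Rightarrow> real \<Rightarrow> real \<Rightarrow> (real \<times> 'b \<Rightarrow> real) \<Rightarrow> real \<times> 'b \<Rightarrow> real" where
  "profile a g e F = (\<lambda>p. sint a F p + g * sint a (\<lambda>p. F p * F p * F p) p + - e * sint a (sint a F) p)"

text \<open>Integration acts on s alone and commutes with normalising y, so the profile can be
  studied through the extension of \<phi>1.\<close>

lemma hom_ext_profile: "hom_ext (profile a g e \<phi>) = profile a g e (hom_ext \<phi>)"
  by (simp add: fun_eq_iff hom_ext_def profile_def sint_def split_beta)

lemma homogeneous_hom_ext: "homogeneous (hom_ext \<phi>)"
  by (simp add: homogeneous_def hom_ext_def sgn_scaleR flip: sgn_div_norm)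

lemma homogeneous_sint: "homogeneous F \<Longrightarrow> homogeneous (sint a F)"
  by (simp add: homogeneous_def sint_def)

lemma homogeneous_profile: "homogeneous F \<Longrightarrow> homogeneous (profile a g e F)"
  by (simp add: homogeneous_def sint_def profile_def)

context
  fixes a b :: real and F :: "real \<times> (real^3) \<Rightarrow> real"
  assumes ab: "0 < a" "a < b" "b < 1"
    and F: "\<And>k. Ck_on k cyl_ext F" and F0: "vanishes_below b F"
begin

private lemma a: "0 < a" "a < 1" and V: "open (- {0} :: (real^3) set)"
  using ab by auto

private lemma Ck_on_sint_cyl:
  "Ck_on k cyl_ext H \<Longrightarrow> vanishes_below b H \<Longrightarrow> Ck_on k cyl_ext (sint a H)"
  unfolding cyl_ext_def by (rule Ck_on_sint[OF V a ab(2)]) (simp_all add: vanishes_below_def)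

private lemma deriv_bound_sint_cyl:
  "Ck_on k cyl_ext H \<Longrightarrow> vanishes_below b H \<Longrightarrow> deriv_bound cyl_ext cyl k H M
    \<Longrightarrow> deriv_bound cyl_ext cyl k (sint a H) M"
  unfolding cyl_ext_def cyl_def
  by (rule deriv_bound_sint[OF V a ab(2)]) (auto simp: vanishes_below_def)

private lemma sint_vanishes: "vanishes_below b H \<Longrightarrow> vanishes_below b (sint a H)"
  unfolding vanishes_below_def by (intro allI impI sint_eq_0[OF a]) simp_all

private lemma sint_deriv:
  assumes "\<And>k. Ck_on k cyl_ext H" "vanishes_below b H" and p: "p \<in> cyl_ext"
  shows "cyl_deriv (1, 0) (sint a H) p = H p"
proof -
  have H: "H differentiable_on cyl_ext" "continuous_on cyl_ext (cyl_deriv v H)" for v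
    by (rule Ck_on_Suc_differentiable[OF assms(1)],
        rule Ck_on_imp_continuous_on[OF Ck_on_Suc_deriv[OF assms(1)]])
  have H0: "H (s, y) = 0" if "0 < s" "s \<le> a" "y \<in> - {0}" for s y
    using assms(2) that ab unfolding vanishes_below_def by simp
  have "(sint a H has_derivative (\<lambda>v. fst v * H p + sint a (cyl_deriv (0, snd v) H) p)) (at p within cyl_ext)"
    unfolding cyl_ext_def
    by (rule has_derivative_sint[OF V a H(1)[unfolded cyl_ext_def] H(2)[unfolded cyl_ext_def] H0 p[unfolded cyl_ext_def]])
  from frechet_derivative_within_eqI[OF axis_accessible_cyl_ext p this]
  have "cyl_deriv (1, 0) (sint a H) p = H p + sint a (cyl_deriv (0, 0) H) p" by simp
  also have "sint a (cyl_deriv (0, 0) H) p = 0"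
    unfolding cyl_ext_def
    by (rule sint_frechet_derivative_zero[OF V a H(1)[unfolded cyl_ext_def] p[unfolded cyl_ext_def]])
  finally show ?thesis by simp
qed

private lemma cube:
  shows "Ck_on k cyl_ext (\<lambda>p. F p * F p * F p)"
    and "deriv_bound cyl_ext cyl k F N \<Longrightarrow> 0 \<le> N \<Longrightarrow>
      deriv_bound cyl_ext cyl k (\<lambda>p. F p * F p * F p) (4 ^ k * N ^ 3)"
proof -
  note ax = axis_accessible_cyl_ext
  have FF: "Ck_on k cyl_ext (\<lambda>p. F p * F p)" by (intro Ck_on_mult ax F)
  show "Ck_on k cyl_ext (\<lambda>p. F p * F p * F p)" by (intro Ck_on_mult ax F)
  assume N: "deriv_bound cyl_ext cyl k F N" "0 \<le> N"
  have "deriv_bound cyl_ext cyl k (\<lambda>p. F p * F p * F p) (2 ^ k * (2 ^ k * N * N) * N)"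
    by (intro deriv_bound_mult[OF ax cyl_subset_cyl_ext] FF F N) (use N in auto)
  moreover have "2 ^ k * (2 ^ k * N * N) * N = 4 ^ k * N ^ 3"
    by (simp add: power3_eq_cube power_mult_distrib[symmetric] mult.assoc[symmetric])
  ultimately show "deriv_bound cyl_ext cyl k (\<lambda>p. F p * F p * F p) (4 ^ k * N ^ 3)" by simp
qed

private lemma cube_vanishes: "vanishes_below b (\<lambda>p. F p * F p * F p)"
  using F0 by (simp add: vanishes_below_def)

lemma profile_vanishes: "vanishes_below b (profile a g e F)"
  using sint_vanishes[OF F0] sint_vanishes[OF sint_vanishes[OF F0]] sint_vanishes[OF cube_vanishes]
  by (simp add: vanishes_below_def profile_def)

lemma Ck_on_profile: "Ck_on k cyl_ext (profile a g e F)"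
  unfolding profile_def
  by (intro Ck_on_add Ck_on_cmult axis_accessible_cyl_ext Ck_on_sint_cyl F F0 cube cube_vanishes sint_vanishes)

text \<open>Integration costs nothing and the two products in the cube cost 2^k each. The parameters
  enter only through their absolute values, which \<open>parameter_bounds\<close> controls
  uniformly.\<close>

lemma deriv_bound_profile:
  assumes N: "deriv_bound cyl_ext cyl k F N" "0 \<le> N"
  shows "deriv_bound cyl_ext cyl k (profile a g e F) (N + \<bar>g\<bar> * (4 ^ k * N ^ 3) + \<bar>- e\<bar> * N)"
  unfolding profile_def
  by (intro deriv_bound_add deriv_bound_cmult axis_accessible_cyl_ext cyl_subset_cyl_ext
      Ck_on_add Ck_on_cmult Ck_on_sint_cyl deriv_bound_sint_cyl F F0 cube cube_vanishes sint_vanishes N)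

lemma profile_deriv:
  assumes p: "p \<in> cyl_ext"
  shows "cyl_deriv (1, 0) (profile a g e F) p = F p + g * F p ^ 3 - e * sint a F p"
proof -
  note D = frechet_derivative_within_has_derivative[OF Ck_on_Suc_differentiable[where k = 0] p]
  have "(profile a g e F has_derivative (\<lambda>v. cyl_deriv v (sint a F) p
      + g * cyl_deriv v (sint a (\<lambda>p. F p * F p * F p)) p + - e * cyl_deriv v (sint a (sint a F)) p))
      (at p within cyl_ext)"
    unfolding profile_def
    by (intro has_derivative_add has_derivative_mult_right D Ck_on_sint_cyl F F0 cube cube_vanishes sint_vanishes)
  from frechet_derivative_within_eqI[OF axis_accessible_cyl_ext p this]
  have "cyl_deriv (1, 0) (profile a g e F) p = cyl_deriv (1, 0) (sint a F) p
      + g * cyl_deriv (1, 0) (sint a (\<lambda>p. F p * F p * F p)) p + - e * cyl_deriv (1, 0) (sint a (sint a F)) p"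
    by simp
  also have "\<dots> = F p + g * (F p * F p * F p) + - e * sint a F p"
    using sint_deriv[OF F F0 p] sint_deriv[of "\<lambda>p. F p * F p * F p", OF cube(1) cube_vanishes p]
      sint_deriv[of "sint a F", OF Ck_on_sint_cyl[OF F F0] sint_vanishes[OF F0] p] by simp
  finally show ?thesis by (simp add: power3_eq_cube)
qed

lemma profile_slope_deriv:
  assumes p: "p \<in> cyl_ext"
  shows "((\<lambda>p. F p + g * F p ^ 3 - e * sint a F p) has_derivative
    (\<lambda>v. cyl_deriv v F p + 3 * g * (F p)\<^sup>2 * cyl_deriv v F p - e * cyl_deriv v (sint a F) p)) (at p within cyl_ext)"
    and "cyl_deriv (1, 0) (\<lambda>p. F p + g * F p ^ 3 - e * sint a F p) p
      = cyl_deriv (1, 0) F p + 3 * g * (F p)\<^sup>2 * cyl_deriv (1, 0) F p - e * F p"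
proof -
  note D = frechet_derivative_within_has_derivative[OF Ck_on_Suc_differentiable[where k = 0] p]
  show d: "((\<lambda>p. F p + g * F p ^ 3 - e * sint a F p) has_derivative
    (\<lambda>v. cyl_deriv v F p + 3 * g * (F p)\<^sup>2 * cyl_deriv v F p - e * cyl_deriv v (sint a F) p)) (at p within cyl_ext)"
    by (rule derivative_eq_intros D[OF F] D[OF Ck_on_sint_cyl[OF F F0]] refl | simp add: fun_eq_iff)+
  show "cyl_deriv (1, 0) (\<lambda>p. F p + g * F p ^ 3 - e * sint a F p) p
      = cyl_deriv (1, 0) F p + 3 * g * (F p)\<^sup>2 * cyl_deriv (1, 0) F p - e * F p"
    unfolding frechet_derivative_within_eqI[OF axis_accessible_cyl_ext p d] sint_deriv[OF F F0 p] ..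
qed

lemma continuous_on_sint_cyl: "continuous_on cyl_ext (sint a F)"
  using Ck_on_imp_continuous_on[OF Ck_on_sint_cyl[OF F F0]] .

lemma abs_sint_le:
  assumes "\<And>p. p \<in> cyl \<Longrightarrow> \<bar>F p\<bar> \<le> M" "p \<in> cyl"
  shows "\<bar>sint a F p\<bar> \<le> M"
  using deriv_bound_sint_cyl[OF F[of 0] F0, of M] assms unfolding deriv_bound_0 by blast

end

section \<open>Estimates uniform in \<delta>, r0 and x\<close>

lemma parameter_bounds:
  fixes \<delta> r :: real
  assumes "0 < \<delta>" "\<delta> < 1" "2 < r"
  shows "0 < \<delta> / r\<^sup>2" "\<delta> / r\<^sup>2 \<le> \<delta>" "\<bar>G / 2 * (\<delta> / r\<^sup>2)\<bar> \<le> \<bar>G\<bar>" "\<bar>- (\<delta> / r)\<bar> \<le> 1"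
proof -
  show "0 < \<delta> / r\<^sup>2" using assms by simp
  have "1 * 1 \<le> r * r" using assms by (intro mult_mono) auto
  then show k: "\<delta> / r\<^sup>2 \<le> \<delta>"
    using assms mult_left_mono[of 1 "r * r" \<delta>] by (simp add: divide_le_eq power2_eq_square)
  have "\<bar>G / 2 * \<kappa>\<bar> \<le> \<bar>G\<bar>" if "0 < \<kappa>" "\<kappa> \<le> 1" for \<kappa>
    using mult_left_mono[of \<kappa> 1 "\<bar>G\<bar>"] that by (simp add: abs_mult)
  then show "\<bar>G / 2 * (\<delta> / r\<^sup>2)\<bar> \<le> \<bar>G\<bar>"
    by this (use \<open>0 < \<delta> / r\<^sup>2\<close> k assms in linarith)+
  show "\<bar>- (\<delta> / r)\<bar> \<le> 1" using assms by simp
qed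

text \<open>C is obtained before \<delta>, r and u are fixed, from the family over all admissible
  triples. For a given u the slice formulas then reduce both norms to the expansion.
  \<open>small\<close> keeps 1 + h away from 0, so the speed is defined and differentiable.\<close>

lemma short_pulse_estimates:
  fixes \<phi>1 :: "real \<times> (real^3) \<Rightarrow> real" and G :: real
  assumes ab: "0 < a" "a < b" "b < 1"
    and CF: "\<And>k. Ck_on k cyl_ext (hom_ext \<phi>1)" and F0: "vanishes_below b (hom_ext \<phi>1)"
    and \<delta>': "\<delta>' \<le> 1"
    and small: "\<And>\<delta> r p. 0 < \<delta> \<Longrightarrow> \<delta> < \<delta>' \<Longrightarrow> 2 < r \<Longrightarrow> p \<in> cyl \<Longrightarrow>
      \<bar>3 * G * (\<delta> / r\<^sup>2) * (hom_ext \<phi>1 p)\<^sup>2\<bar> \<le> 1 / 2"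
  shows "\<exists>C. \<forall>\<delta> r u. 0 < \<delta> \<and> \<delta> < \<delta>' \<and> 2 < r \<and>
      solves_initially G r \<delta> (profile a (G / 2 * (\<delta> / r\<^sup>2)) (\<delta> / r) \<phi>1) \<phi>1 u \<longrightarrow>
    Linf_norm (annulus r \<delta>) (\<lambda>x. Lbar G u u (-r, x)) \<le> ereal (C * \<delta> powr (3/2) / r\<^sup>2) \<and>
    Linf_norm (annulus r \<delta>) (\<lambda>x. Lbar G u (Lbar G u u) (-r, x)) \<le> ereal (C * \<delta> powr (3/2) / r ^ 3)"
proof -
  define F where "F = hom_ext \<phi>1"
  note CF = CF[folded F_def] and F0 = F0[folded F_def] and small = small[folded F_def]
  define P where "P \<delta> r = profile a (G / 2 * (\<delta> / r\<^sup>2)) (\<delta> / r) F" for \<delta> r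
  define E where "E \<delta> r x = ((norm x - r) / \<delta>, x /\<^sub>R norm x)" for \<delta> r and x :: "real^3"
  define q where "q \<delta> r x = (\<Sum>e\<in>Basis. cyl_deriv (0, e) (cyl_deriv (0, e) (P \<delta> r)) (E \<delta> r x))"
    for \<delta> r and x :: "real^3"
  define X where "X = {i :: real \<times> real \<times> (real^3). 0 < fst i \<and> fst i < \<delta>' \<and> 2 < fst (snd i) \<and>
    fst (snd i) < norm (snd (snd i)) \<and> norm (snd (snd i)) < fst (snd i) + fst i}"
  have E_cyl: "E \<delta> r x \<in> cyl" if "0 < \<delta>" "2 < r" "r < norm x" "norm x < r + \<delta>" for \<delta> r x
  proof -
    have "norm x \<noteq> 0" using that by linarith
    then show ?thesis using that by (simp add: E_def cyl_def)
  qed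
  have EX: "E (fst i) (fst (snd i)) (snd (snd i)) \<in> cyl" if "i \<in> X" for i
    using that by (intro E_cyl) (auto simp: X_def)
  have bdd_F: "bdd_on X (\<lambda>i. H (E (fst i) (fst (snd i)) (snd (snd i))))"
    if "deriv_bound cyl_ext cyl 0 H N" for H N
    using that EX by (intro bdd_onI[of _ _ N]) (auto simp: deriv_bound_0)
  \<comment> \<open>Order 2 because q contains second y-derivatives of the profile, which are
    controlled by derivatives of \<phi>1 of order at most 2.\<close>
  obtain N2 where N2: "deriv_bound cyl_ext cyl 2 F N2"
    using deriv_bound_exists[OF _ CF F0] ab by force
  obtain e :: "real^3" where e: "e \<in> Basis" using nonempty_Basis by blast
  have N2_nonneg: "0 \<le> N2"
    using deriv_bound_D0[OF N2, of "(1, e)"] e by (force simp: cyl_def)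
  have N2': "deriv_bound cyl_ext cyl 1 F N2" "deriv_bound cyl_ext cyl 0 F N2"
    using N2 deriv_bound_SucD[of _ _ 1 F N2] deriv_bound_SucD[of _ _ 0 F N2] by (simp_all add: numeral_2_eq_2)
  have "deriv_bound cyl_ext cyl 0 (cyl_deriv (1, 0) F) N2"
    using N2'(1) unfolding One_nat_def deriv_bound_Suc by (auto simp: Basis_prod_def)
  note bdd_Fs = bdd_F[OF this]
  have bdd_J: "bdd_on X (\<lambda>i. sint a F (E (fst i) (fst (snd i)) (snd (snd i))))"
    using abs_sint_le[OF ab CF F0, of N2] N2'(2) EX
    by (intro bdd_onI[of _ _ N2]) (auto simp: deriv_bound_0)
  define Q where "Q = N2 + \<bar>G\<bar> * (4 ^ 2 * N2 ^ 3) + 1 * N2"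
  have bdd_q: "bdd_on X (\<lambda>i. q (fst i) (fst (snd i)) (snd (snd i)))"
  proof (rule bdd_onI)
    fix i assume i: "i \<in> X"
    define \<delta> r x where "\<delta> = fst i" and "r = fst (snd i)" and "x = snd (snd i)"
    have par: "0 < \<delta>" "\<delta> < 1" "2 < r" using i \<delta>' by (auto simp: X_def \<delta>_def r_def)
    have "N2 + \<bar>G / 2 * (\<delta> / r\<^sup>2)\<bar> * (4 ^ 2 * N2 ^ 3) + \<bar>- (\<delta> / r)\<bar> * N2 \<le> Q"
      unfolding Q_def using parameter_bounds[OF par] N2_nonneg
      by (intro add_mono mult_right_mono) auto
    then have P: "deriv_bound cyl_ext cyl 2 (P \<delta> r) Q"
      unfolding P_def by (rule deriv_bound_mono[OF deriv_bound_profile[OF ab CF F0 N2 N2_nonneg]])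
    have "\<bar>cyl_deriv (0, e) (cyl_deriv (0, e) (P \<delta> r)) (E \<delta> r x)\<bar> \<le> Q" if "e \<in> Basis" for e
      using P[unfolded deriv_bound_def, rule_format, of "[(0, e), (0, e)]" "E \<delta> r x"] that EX[OF i]
      by (simp add: Basis_prod_def \<delta>_def r_def x_def)
    then have "\<bar>q \<delta> r x\<bar> \<le> (\<Sum>e\<in>(Basis :: (real^3) set). Q)"
      unfolding q_def by (intro order_trans[OF sum_abs] sum_mono)
    then show "\<bar>q (fst i) (fst (snd i)) (snd (snd i))\<bar> \<le> (\<Sum>e\<in>(Basis :: (real^3) set). Q)"
      by (simp only: \<delta>_def r_def x_def)
  qed
  have c: "0 < (1 + h) powr (-1/2) \<and> ((1 + h) powr (-1/2))\<^sup>2 * (1 + h) = 1" if "\<bar>h\<bar> \<le> 1 / 2" for h :: real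
  proof -
    have "((1 + h) powr (-1/2))\<^sup>2 = (1 + h) powr (-1)"
      using that by (simp add: power2_eq_square powr_add[symmetric])
    then show ?thesis using that by (auto simp: powr_minus)
  qed
  let ?a = "\<lambda>i. F (E (fst i) (fst (snd i)) (snd (snd i)))"
  \<comment> \<open>The conclusion of the expansion at a single index, folded so that it can later
    be instantiated at (\<delta>, r, x) and matched with the pointwise abbreviations.\<close>
  define est where "est C i \<longleftrightarrow>
    (let \<delta> = fst i; r = fst (snd i); R = norm (snd (snd i)); a' = ?a i;
      b' = cyl_deriv (1, 0) F (E (fst i) (fst (snd i)) (snd (snd i)));
      w = a' + G / 2 * (\<delta> / r\<^sup>2) * a' ^ 3 - \<delta> / r * sint a F (E (fst i) (fst (snd i)) (snd (snd i)));
      z = b' + 3 / 2 * G * (\<delta> / r\<^sup>2) * a'\<^sup>2 * b' - \<delta> / r * a';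
      L = z + 2 * \<delta> / R * w + (\<delta> / R)\<^sup>2 * q (fst i) (fst (snd i)) (snd (snd i));
      c = (1 + 3 * G * (\<delta> / r\<^sup>2) * a'\<^sup>2) powr (-1/2)
    in \<bar>a' - c * w\<bar> \<le> C * (\<delta> / r) \<and>
      \<bar>c\<^sup>2 * (L + z) + 3 * G * (\<delta> / r\<^sup>2) * c ^ 5 * a' * w * L
        - 2 * c * b' - 3 * G * (\<delta> / r\<^sup>2) * c ^ 4 * a' * w * b'\<bar> \<le> C * (\<delta> / r)\<^sup>2)" for C i
  have "\<exists>C. \<forall>i\<in>X. est C i"
    unfolding est_def Let_def
  proof (rule short_pulse_expansion[where X = X and a = ?a and G = G and \<delta> = fst
        and r = "\<lambda>i. fst (snd i)" and R = "\<lambda>i. norm (snd (snd i))"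
        and b = "\<lambda>i. cyl_deriv (1, 0) F (E (fst i) (fst (snd i)) (snd (snd i)))"
        and J = "\<lambda>i. sint a F (E (fst i) (fst (snd i)) (snd (snd i)))"
        and q = "\<lambda>i. q (fst i) (fst (snd i)) (snd (snd i))"
        and c = "\<lambda>i. (1 + 3 * G * (fst i / (fst (snd i))\<^sup>2) * (?a i)\<^sup>2) powr (-1/2)"])
    show "bdd_on X ?a" by (rule bdd_F[OF N2'(2)])
    fix i assume i: "i \<in> X"
    then show "0 < fst i \<and> fst i < 1 \<and> 2 < fst (snd i) \<and> fst (snd i) < norm (snd (snd i)) \<and>
        norm (snd (snd i)) < fst (snd i) + fst i"
      using \<delta>' by (auto simp: X_def)
    show h: "\<bar>3 * G * (fst i / (fst (snd i))\<^sup>2) * (?a i)\<^sup>2\<bar> \<le> 1 / 2"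
      using i EX[OF i] by (intro small) (auto simp: X_def)
    show "0 < (1 + 3 * G * (fst i / (fst (snd i))\<^sup>2) * (?a i)\<^sup>2) powr (-1/2) \<and>
        ((1 + 3 * G * (fst i / (fst (snd i))\<^sup>2) * (?a i)\<^sup>2) powr (-1/2))\<^sup>2
          * (1 + 3 * G * (fst i / (fst (snd i))\<^sup>2) * (?a i)\<^sup>2) = 1"
      by (rule c[OF h])
  qed (rule bdd_Fs bdd_J bdd_q)+
  then obtain C where C: "\<And>i. i \<in> X \<Longrightarrow> est C i" by blast
  show ?thesis
  proof (intro exI[of _ C] allI impI, elim conjE, intro conjI)
    fix \<delta> r u
    assume par: "0 < \<delta>" "\<delta> < \<delta>'" "2 < r"
      and sol: "solves_initially G r \<delta> (profile a (G / 2 * (\<delta> / r\<^sup>2)) (\<delta> / r) \<phi>1) \<phi>1 u"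
    let ?\<Omega> = "{x :: real^3. r < norm x \<and> norm x < r + \<delta>}"
    define g \<epsilon> where "g = G / 2 * (\<delta> / r\<^sup>2)" and "\<epsilon> = \<delta> / r"
    define W where "W = (\<lambda>p. F p + g * F p ^ 3 - \<epsilon> * sint a F p)"
    \<comment> \<open>The amplitude of \<partial>t u. Its square is the coefficient \<delta> / r^2
      of the nonlinearity, and B \<delta> is the amplitude of u.\<close>
    define B where "B = \<delta> powr (1/2) / r"
    have B2: "B\<^sup>2 = \<delta> / r\<^sup>2"
      using par by (simp add: B_def power_divide powr_half_sqrt)
    have A: "\<delta> powr (3/2) / r = B * \<delta>"
      using par powr_add[of \<delta> "1/2" 1] by (simp add: B_def)
    obtain U where U: "open U" "{-r} \<times> ball 0 (r + \<delta>) \<subseteq> U" "Ck_on 2 U u"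
      and wave: "\<And>x. x \<in> ball 0 (r + \<delta>) \<Longrightarrow> wave_eq G u (-r, x)"
      and data: "short_pulse_data r \<delta> (profile a (G / 2 * (\<delta> / r\<^sup>2)) (\<delta> / r) \<phi>1) \<phi>1 u"
      using sol unfolding solves_initially_def by blast
    have P_eq: "P \<delta> r (s, y) = profile a (G / 2 * (\<delta> / r\<^sup>2)) (\<delta> / r) \<phi>1 (s, y /\<^sub>R norm y)" for s y
      unfolding P_def F_def hom_ext_profile[symmetric] by (simp add: hom_ext_def)
    have data': "u (-r, y) = B * \<delta> * P \<delta> r ((norm y - r) / \<delta>, y)
        \<and> dt u (-r, y) = B * F ((norm y - r) / \<delta>, y)"
      if "r < norm y" "norm y < r + \<delta>" for y
      using data that unfolding short_pulse_data_def A[symmetric]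
      by (simp add: P_eq F_def hom_ext_def B_def)
    have W': "cyl_deriv (1, 0) (P \<delta> r) p = W p" if "p \<in> cyl_ext" for p
      unfolding P_def W_def g_def \<epsilon>_def by (rule profile_deriv[OF ab CF F0 that])
    have Wd: "W differentiable_on cyl_ext"
      unfolding W_def differentiable_on_def differentiable_def
      using profile_slope_deriv(1)[OF ab CF F0] by blast
    have hF: "homogeneous F" unfolding F_def by (rule homogeneous_hom_ext)
    have hW: "homogeneous W"
      using hF homogeneous_sint[OF hF] by (simp add: homogeneous_def W_def)
    have r0: "0 < r" using par by simp
    have CP: "Ck_on k cyl_ext (P \<delta> r)" for k
      unfolding P_def by (rule Ck_on_profile[OF ab CF F0])
    note slice = short_pulse_slice[OF U r0 par(1) data' homogeneous_profile[OF hF, of a g \<epsilon>, unfolded g_def \<epsilon>_def, folded P_def]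
        CP hF Ck_on_Suc_differentiable[OF CF[of "Suc 0"]] hW Wd W', folded E_def, folded q_def]
    define aa where "aa x = F (E \<delta> r x)" for x
    define bb where "bb x = cyl_deriv (1, 0) F (E \<delta> r x)" for x
    define ww where "ww x = aa x + G / 2 * (\<delta> / r\<^sup>2) * aa x ^ 3 - \<delta> / r * sint a F (E \<delta> r x)" for x
    define zz where "zz x = bb x + 3 / 2 * G * (\<delta> / r\<^sup>2) * (aa x)\<^sup>2 * bb x - \<delta> / r * aa x" for x
    define LL where "LL x = zz x + 2 * \<delta> / norm x * ww x + (\<delta> / norm x)\<^sup>2 * q \<delta> r x" for x
    define cc where "cc x = (1 + 3 * G * (\<delta> / r\<^sup>2) * (aa x)\<^sup>2) powr (-1/2)" for x
    define L1 where "L1 x = aa x - cc x * ww x" for x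
    define L2 where "L2 x = (cc x)\<^sup>2 * (LL x + zz x) + 3 * G * (\<delta> / r\<^sup>2) * cc x ^ 5 * aa x * ww x * LL x
        - 2 * cc x * bb x - 3 * G * (\<delta> / r\<^sup>2) * cc x ^ 4 * aa x * ww x * bb x" for x
    have bounds: "\<bar>L1 x\<bar> \<le> C * (\<delta> / r) \<and> \<bar>L2 x\<bar> \<le> C * (\<delta> / r)\<^sup>2" if "x \<in> ?\<Omega>" for x
    proof -
      have "(\<delta>, r, x) \<in> X" using that par by (simp add: X_def)
      from C[OF this] show ?thesis
        unfolding est_def Let_def fst_conv snd_conv L1_def L2_def LL_def zz_def ww_def cc_def aa_def bb_def .
    qed
    have Lbars: "Lbar G u u (-r, x) = B * L1 x \<and> Lbar G u (Lbar G u u) (-r, x) = B / \<delta> * L2 x"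
      if x: "x \<in> ?\<Omega>" for x
    proof -
      have x1: "r < norm x" "norm x < r + \<delta>" and x0: "x \<noteq> 0" using x r0 by auto
      have Ec: "E \<delta> r x \<in> cyl_ext" using E_cyl[OF par(1,3) x1] cyl_subset_cyl_ext by blast
      have h: "\<bar>3 * G * (\<delta> / r\<^sup>2) * (aa x)\<^sup>2\<bar> \<le> 1 / 2"
        unfolding aa_def by (intro small par E_cyl x1)
      have ut: "dt u (-r, x) = B * aa x" using slice(1)[OF _ _ _ x1] unfolding aa_def by simp
      have w: "W (E \<delta> r x) = ww x" by (simp add: W_def ww_def aa_def g_def \<epsilon>_def)
      have z: "cyl_deriv (1, 0) W (E \<delta> r x) = zz x"
        unfolding W_def profile_slope_deriv(2)[OF ab CF F0 Ec]
        by (simp add: zz_def aa_def bb_def g_def \<epsilon>_def)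
      have ur: "dr u (-r, x) = B * ww x" using slice(2)[OF _ _ _ x1] par w by simp
      have urt: "dr (dt u) (-r, x) = B / \<delta> * bb x" using slice(3)[OF _ _ _ x1] unfolding bb_def by simp
      have urr: "dr (dr u) (-r, x) = B / \<delta> * zz x"
        using slice(4)[OF _ _ _ x1] par z by (simp add: power2_eq_square)
      have lap: "laplacian u (-r, x) = B / \<delta> * LL x"
      proof -
        have "laplacian u (-r, x) = B * \<delta> * (zz x / \<delta>\<^sup>2 + 2 * ww x / (norm x * \<delta>) + q \<delta> r x / (norm x)\<^sup>2)"
          using slice(5)[OF _ _ _ x1] unfolding z w by simp
        also have "\<dots> = B / \<delta> * LL x"
          using par x0 by (simp add: LL_def field_simps power2_eq_square)
        finally show ?thesis .
      qed
      have ut2: "3 * G * (dt u (-r, x))\<^sup>2 = 3 * G * (\<delta> / r\<^sup>2) * (aa x)\<^sup>2"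
        unfolding ut power_mult_distrib B2 by simp
      have sp: "speed G u (-r, x) = cc x" unfolding speed_def ut2 cc_def ..
      have c1: "(cc x)\<^sup>2 * (1 + 3 * G * (\<delta> / r\<^sup>2) * (aa x)\<^sup>2) = 1"
        unfolding cc_def using c[OF h] by blast
      have "(1 + 3 * G * (\<delta> / r\<^sup>2) * (aa x)\<^sup>2) * dt (dt u) (-r, x) = laplacian u (-r, x)"
        using wave[of x] x1 unfolding wave_eq_def ut2 minus_mult_left[symmetric] by simp
      then have "(cc x)\<^sup>2 * (1 + 3 * G * (\<delta> / r\<^sup>2) * (aa x)\<^sup>2) * dt (dt u) (-r, x) = (cc x)\<^sup>2 * laplacian u (-r, x)"
        by (simp only: mult.assoc)
      then have utt: "dt (dt u) (-r, x) = (cc x)\<^sup>2 * (B / \<delta> * LL x)"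
        unfolding c1 lap by simp
      have "0 < 1 + 3 * G * (dt u (-r, x))\<^sup>2" unfolding ut2 using h by linarith
      moreover have "(-r, x) \<in> U" using U(2) x1 by auto
      ultimately have "Lbar G u (Lbar G u u) (-r, x) =
          (cc x)\<^sup>2 * (B / \<delta> * LL x) + 3 * G * cc x ^ 3 * (B * aa x) * ((cc x)\<^sup>2 * (B / \<delta> * LL x)) * (B * ww x)
          - 2 * cc x * (B / \<delta> * bb x) - 3 * G * cc x ^ 4 * (B * aa x) * (B / \<delta> * bb x) * (B * ww x)
          + (cc x)\<^sup>2 * (B / \<delta> * zz x)"
        using Lbar_Lbar[OF U(1) _ U(3) x0, of "-r" G] unfolding sp ut ur urt urr utt by simp
      also have "\<dots> = B / \<delta> * ((cc x)\<^sup>2 * (LL x + zz x) + 3 * G * B\<^sup>2 * cc x ^ 5 * aa x * ww x * LL x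
        - 2 * cc x * bb x - 3 * G * B\<^sup>2 * cc x ^ 4 * aa x * ww x * bb x)"
        by (simp add: algebra_simps eval_nat_numeral)
      finally have "Lbar G u (Lbar G u u) (-r, x) = B / \<delta> * L2 x" unfolding B2 L2_def .
      moreover have "Lbar G u u (-r, x) = B * L1 x"
        unfolding Lbar_def sp ut ur L1_def by (simp add: algebra_simps)
      ultimately show ?thesis by simp
    qed
    \<comment> \<open>Continuity in x makes the two functions measurable on the open annulus; it is
      read off from the explicit expressions.\<close>
    have cE: "continuous_on ?\<Omega> (\<lambda>x. H (E \<delta> r x))" if "continuous_on cyl_ext H" for H
    proof (rule continuous_on_compose2[OF that])
      show "continuous_on ?\<Omega> (E \<delta> r)"
        unfolding E_def using r0 par by (intro continuous_intros) auto
      show "E \<delta> r ` ?\<Omega> \<subseteq> cyl_ext"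
        using E_cyl[OF par(1,3)] cyl_subset_cyl_ext by blast
    qed
    have c_aa: "continuous_on ?\<Omega> aa" and c_bb: "continuous_on ?\<Omega> bb"
      unfolding aa_def[abs_def] bb_def[abs_def]
      by (intro cE Ck_on_imp_continuous_on[OF CF] Ck_on_imp_continuous_on[OF Ck_on_Suc_deriv[OF CF]])+
    have c_q: "continuous_on ?\<Omega> (q \<delta> r)"
      unfolding q_def[abs_def]
      by (intro continuous_on_sum cE Ck_on_imp_continuous_on[where k = 0]
          Ck_on_Suc_deriv[of 0] Ck_on_Suc_deriv[of "Suc 0"] CP)
    have c_ww: "continuous_on ?\<Omega> ww"
      unfolding ww_def[abs_def]
      by (intro continuous_intros c_aa cE continuous_on_sint_cyl[OF ab CF F0])
    have c_zz: "continuous_on ?\<Omega> zz" unfolding zz_def[abs_def] by (intro continuous_intros c_aa c_bb)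
    have c_LL: "continuous_on ?\<Omega> LL"
      unfolding LL_def[abs_def] using r0 by (intro continuous_intros c_zz c_ww c_q) auto
    have c_cc: "continuous_on ?\<Omega> cc"
      unfolding cc_def[abs_def]
    proof (intro continuous_on_powr continuous_intros c_aa ballI)
      fix x assume "x \<in> ?\<Omega>"
      then have "\<bar>3 * G * (\<delta> / r\<^sup>2) * (aa x)\<^sup>2\<bar> \<le> 1 / 2"
        unfolding aa_def by (intro small par E_cyl) auto
      then show "1 + 3 * G * (\<delta> / r\<^sup>2) * (aa x)\<^sup>2 \<noteq> 0" by linarith
    qed
    have c_L: "continuous_on ?\<Omega> (\<lambda>x. B * L1 x)" "continuous_on ?\<Omega> (\<lambda>x. B / \<delta> * L2 x)"
      unfolding L1_def L2_def by (intro continuous_intros c_aa c_bb c_cc c_ww c_zz c_LL)+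
    have B0: "0 < B" using par by (simp add: B_def)
    show "Linf_norm (annulus r \<delta>) (\<lambda>x. Lbar G u u (-r, x)) \<le> ereal (C * \<delta> powr (3/2) / r\<^sup>2)"
    proof (rule Linf_norm_annulus_le)
      show "continuous_on ?\<Omega> (\<lambda>x. Lbar G u u (-r, x))"
        using c_L(1) by (rule continuous_on_eq) (simp add: Lbars)
      fix x :: "real^3" assume "r < norm x" "norm x < r + \<delta>"
      then have x: "x \<in> ?\<Omega>" by simp
      have "\<bar>Lbar G u u (-r, x)\<bar> = B * \<bar>L1 x\<bar>" using Lbars[OF x] B0 by (simp add: abs_mult)
      also have "\<dots> \<le> B * (C * (\<delta> / r))" using bounds[OF x] B0 by (intro mult_left_mono) auto
      also have "\<dots> = C * (B * \<delta>) / r" by simp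
      also have "\<dots> = C * \<delta> powr (3/2) / r\<^sup>2" unfolding A[symmetric] by (simp add: power2_eq_square)
      finally show "\<bar>Lbar G u u (-r, x)\<bar> \<le> C * \<delta> powr (3/2) / r\<^sup>2" .
    qed
    show "Linf_norm (annulus r \<delta>) (\<lambda>x. Lbar G u (Lbar G u u) (-r, x)) \<le> ereal (C * \<delta> powr (3/2) / r ^ 3)"
    proof (rule Linf_norm_annulus_le)
      show "continuous_on ?\<Omega> (\<lambda>x. Lbar G u (Lbar G u u) (-r, x))"
        using c_L(2) by (rule continuous_on_eq) (simp add: Lbars)
      fix x :: "real^3" assume "r < norm x" "norm x < r + \<delta>"
      then have x: "x \<in> ?\<Omega>" by simp
      have "\<bar>Lbar G u (Lbar G u u) (-r, x)\<bar> = B / \<delta> * \<bar>L2 x\<bar>"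
        using Lbars[OF x] B0 par by (simp add: abs_mult)
      also have "\<dots> \<le> B / \<delta> * (C * (\<delta> / r)\<^sup>2)" using bounds[OF x] B0 par by (intro mult_left_mono) auto
      also have "\<dots> = C * (B * \<delta>) / r\<^sup>2" using par by (simp add: power2_eq_square)
      also have "\<dots> = C * \<delta> powr (3/2) / r ^ 3" unfolding A[symmetric] by (simp add: eval_nat_numeral)
      finally show "\<bar>Lbar G u (Lbar G u u) (-r, x)\<bar> \<le> C * \<delta> powr (3/2) / r ^ 3" .
    qed
  qed
qed

theorem lemma1p1:
  fixes G2 :: real
  assumes "G2 \<noteq> 0"
  shows "\<exists>\<Phi> :: nat \<Rightarrow> real \<Rightarrow> real \<Rightarrow> real.
    \<forall>\<phi>1 \<phi>2. seed_data \<phi>1 \<phi>2 \<longrightarrow>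
      (\<exists>\<delta>'>0. \<exists>C::real. \<forall>\<delta> r0. 0 < \<delta> \<and> \<delta> < \<delta>' \<and> r0 > 2 \<longrightarrow>
        (\<exists>\<phi>0. smooth_cyl \<phi>0 \<and> vanishes_near_zero \<phi>0 \<and>
          (\<forall>k. Ck_norm k \<phi>0 \<le>
             ereal (\<Phi> k (real_of_ereal (Ck_norm k \<phi>1)) (real_of_ereal (Ck_norm k \<phi>2)))) \<and>
          (\<forall>u. solves_initially G2 r0 \<delta> \<phi>0 \<phi>1 u \<longrightarrow>
             Linf_norm (annulus r0 \<delta>) (\<lambda>x. Lbar G2 u u (-r0, x))
               \<le> ereal (C * \<delta> powr (3/2) / r0^2) \<and>
             Linf_norm (annulus r0 \<delta>) (\<lambda>x. Lbar G2 u (Lbar G2 u u) (-r0, x))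
               \<le> ereal (C * \<delta> powr (3/2) / r0^3))))"
proof (intro exI[of _ "\<lambda>k N1 N2. N1 + \<bar>G2\<bar> * (4 ^ k * N1 ^ 3) + 1 * N1"] allI impI)
  \<comment> \<open>In the witness for \<open>\<Phi>\<close>, |G2| and 1 bound the coefficients (G2
    / 2) \<kappa> and \<epsilon> of the profile, which removes \<delta> and r0 from
    \<open>deriv_bound_profile\<close>.\<close>
  fix \<phi>1 \<phi>2
  assume "seed_data \<phi>1 \<phi>2"
  then have CF: "\<And>k. Ck_on k cyl_ext (hom_ext \<phi>1)" and "vanishes_near_zero \<phi>1"
    by (auto simp: seed_data_def smooth_cyl_def)
  then obtain b0 where b0: "0 < b0" "\<And>s \<theta>. (s, \<theta>) \<in> cyl \<Longrightarrow> s < b0 \<Longrightarrow> \<phi>1 (s, \<theta>) = 0"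
    unfolding vanishes_near_zero_def by fast
  \<comment> \<open>The cap 1/2 forces b < 1; any a strictly between 0 and b would do.\<close>
  define b where "b = min b0 (1 / 2)"
  define a where "a = b / 2"
  have ab: "0 < a" "a < b" "b < 1" using b0 by (auto simp: a_def b_def)
  have F0: "vanishes_below b (hom_ext \<phi>1)"
    using b0 by (auto simp: vanishes_below_def b_def hom_ext_def cyl_def)
  define N where "N k = real_of_ereal (Ck_norm k \<phi>1)" for k
  \<comment> \<open>\<open>real_of_ereal\<close> sends infinity to 0, so \<open>N k\<close> is the
    norm only because \<open>deriv_bound_exists\<close> makes that norm finite.\<close>
  have N: "deriv_bound cyl_ext cyl k (hom_ext \<phi>1) (N k)" "0 \<le> N k" for k
  proof -
    have "0 < b" using ab by linarith
    from deriv_bound_exists[OF this CF F0] obtain M where "Ck_norm k \<phi>1 \<le> ereal M"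
      using Ck_norm_le_iff by blast
    then have "ereal (N k) = Ck_norm k \<phi>1"
      unfolding N_def using Ck_norm_nonneg[of k \<phi>1] by (cases "Ck_norm k \<phi>1") auto
    then show "deriv_bound cyl_ext cyl k (hom_ext \<phi>1) (N k)" "0 \<le> N k"
      using Ck_norm_le_iff[of k \<phi>1 "N k"] Ck_norm_nonneg[of k \<phi>1] by (simp, metis ereal_less_eq(5))
  qed
  \<comment> \<open>With \<delta>' = 1 / D, |h| is at most (D - 1) / (2 D) < 1 / 2; the summand 1
    also gives \<delta>' at most 1.\<close>
  define D where "D = 6 * \<bar>G2\<bar> * (N 0)\<^sup>2 + 1"
  have D: "1 \<le> D" by (simp add: D_def)
  define \<delta>' where "\<delta>' = 1 / D"
  have \<delta>': "0 < \<delta>'" "\<delta>' \<le> 1" using D by (simp_all add: \<delta>'_def)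
  have small: "\<bar>3 * G2 * (\<delta> / r\<^sup>2) * (hom_ext \<phi>1 p)\<^sup>2\<bar> \<le> 1 / 2"
    if par: "0 < \<delta>" "\<delta> < \<delta>'" "2 < r" and p: "p \<in> cyl" for \<delta> r p
  proof -
    have "(hom_ext \<phi>1 p)\<^sup>2 \<le> (N 0)\<^sup>2"
      using deriv_bound_D0[OF N(1) p] N(2)[of 0] by (simp add: abs_le_square_iff[symmetric])
    moreover have "0 < \<delta> / r\<^sup>2" "\<delta> / r\<^sup>2 \<le> \<delta>'"
      using parameter_bounds(1,2)[of \<delta> r] par \<delta>' by auto
    ultimately have "3 * \<bar>G2\<bar> * (\<delta> / r\<^sup>2) * (hom_ext \<phi>1 p)\<^sup>2 \<le> 3 * \<bar>G2\<bar> * \<delta>' * (N 0)\<^sup>2"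
      by (intro mult_mono) auto
    also have "\<dots> = 3 * \<bar>G2\<bar> * (N 0)\<^sup>2 / D" by (simp add: \<delta>'_def)
    also have "3 * \<bar>G2\<bar> * (N 0)\<^sup>2 = (D - 1) / 2" by (simp add: D_def)
    also have "(D - 1) / 2 / D \<le> 1 / 2" using D by (simp add: field_simps)
    finally show ?thesis using par by (simp add: abs_mult)
  qed
  obtain C where C: "\<forall>\<delta> r u. 0 < \<delta> \<and> \<delta> < \<delta>' \<and> 2 < r \<and>
      solves_initially G2 r \<delta> (profile a (G2 / 2 * (\<delta> / r\<^sup>2)) (\<delta> / r) \<phi>1) \<phi>1 u \<longrightarrow>
    Linf_norm (annulus r \<delta>) (\<lambda>x. Lbar G2 u u (-r, x)) \<le> ereal (C * \<delta> powr (3/2) / r\<^sup>2) \<and>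
    Linf_norm (annulus r \<delta>) (\<lambda>x. Lbar G2 u (Lbar G2 u u) (-r, x)) \<le> ereal (C * \<delta> powr (3/2) / r ^ 3)"
    using short_pulse_estimates[OF ab CF F0 \<delta>'(2) small] by blast
  show "\<exists>\<delta>'>0. \<exists>C::real. \<forall>\<delta> r0. 0 < \<delta> \<and> \<delta> < \<delta>' \<and> r0 > 2 \<longrightarrow>
        (\<exists>\<phi>0. smooth_cyl \<phi>0 \<and> vanishes_near_zero \<phi>0 \<and>
          (\<forall>k. Ck_norm k \<phi>0 \<le> ereal (real_of_ereal (Ck_norm k \<phi>1)
              + \<bar>G2\<bar> * (4 ^ k * real_of_ereal (Ck_norm k \<phi>1) ^ 3) + 1 * real_of_ereal (Ck_norm k \<phi>1))) \<and>
          (\<forall>u. solves_initially G2 r0 \<delta> \<phi>0 \<phi>1 u \<longrightarrow>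
             Linf_norm (annulus r0 \<delta>) (\<lambda>x. Lbar G2 u u (-r0, x))
               \<le> ereal (C * \<delta> powr (3/2) / r0^2) \<and>
             Linf_norm (annulus r0 \<delta>) (\<lambda>x. Lbar G2 u (Lbar G2 u u) (-r0, x))
               \<le> ereal (C * \<delta> powr (3/2) / r0^3)))"
    unfolding N_def[symmetric]
  proof (rule exI[of _ \<delta>'], intro exI[of _ C] conjI allI impI \<delta>'(1))
    fix \<delta> r0 :: real
    assume par: "0 < \<delta> \<and> \<delta> < \<delta>' \<and> 2 < r0"
    define \<phi>0 where "\<phi>0 = profile a (G2 / 2 * (\<delta> / r0\<^sup>2)) (\<delta> / r0) \<phi>1"
    have "smooth_cyl \<phi>0"
      unfolding smooth_cyl_def \<phi>0_def hom_ext_profile using Ck_on_profile[OF ab CF F0] by blast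
    moreover have "vanishes_near_zero \<phi>0"
    proof -
      have "\<phi>0 (s, \<theta>) = 0" if p: "(s, \<theta>) \<in> cyl" "s < b" for s \<theta>
      proof -
        have "hom_ext \<phi>0 (s, \<theta>) = 0"
          using profile_vanishes[OF ab CF F0, unfolded vanishes_below_def, rule_format, of s \<theta>] p
          unfolding \<phi>0_def hom_ext_profile cyl_def by fastforce
        then show ?thesis using p by (simp add: hom_ext_def cyl_def)
      qed
      moreover have "0 < b" using ab by linarith
      ultimately show ?thesis unfolding vanishes_near_zero_def by blast
    qed
    moreover have "Ck_norm k \<phi>0 \<le> ereal (N k + \<bar>G2\<bar> * (4 ^ k * N k ^ 3) + 1 * N k)" for k
      unfolding Ck_norm_le_iff \<phi>0_def hom_ext_profile
    proof (rule deriv_bound_mono[OF deriv_bound_profile[OF ab CF F0 N]])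
      show "N k + \<bar>G2 / 2 * (\<delta> / r0\<^sup>2)\<bar> * (4 ^ k * N k ^ 3) + \<bar>- (\<delta> / r0)\<bar> * N k
          \<le> N k + \<bar>G2\<bar> * (4 ^ k * N k ^ 3) + 1 * N k"
        using parameter_bounds(3,4)[of \<delta> r0] par \<delta>' N(2)[of k]
        by (intro add_mono mult_right_mono) auto
    qed
    moreover note C[rule_format, of \<delta> r0, folded \<phi>0_def]
    ultimately show "\<exists>\<phi>0. smooth_cyl \<phi>0 \<and> vanishes_near_zero \<phi>0 \<and>
          (\<forall>k. Ck_norm k \<phi>0 \<le> ereal (N k + \<bar>G2\<bar> * (4 ^ k * N k ^ 3) + 1 * N k)) \<and>
          (\<forall>u. solves_initially G2 r0 \<delta> \<phi>0 \<phi>1 u \<longrightarrow>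
             Linf_norm (annulus r0 \<delta>) (\<lambda>x. Lbar G2 u u (-r0, x))
               \<le> ereal (C * \<delta> powr (3/2) / r0^2) \<and>
             Linf_norm (annulus r0 \<delta>) (\<lambda>x. Lbar G2 u (Lbar G2 u u) (-r0, x))
               \<le> ereal (C * \<delta> powr (3/2) / r0^3))"
      using par by (intro exI[of _ \<phi>0]) auto
  qed
qed

end
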